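(* Let $R$ be a ring. Suppose that for every $\mathfrak{p}\in\mathrm{ZL}(R)\setminus\mathrm{Max}(Z(R))$ the map $\phi_{\mathfrak{p}}$ is an injection and the ring $k(\mathfrak{p})\otimes_{Z(R)}R/R\mathfrak{p}$ is a simple artinian ring. Then the following statements are equivalent: 1. The ring $R$ is a PLM-ring. 2. The map $\phi_{\mathfrak{p}}$ is not a surjection for all $\mathfrak{p}\in\mathrm{ZL}(R)\setminus\mathrm{Max}(Z(R))$. 3. $\mathrm{soc}_R(R/R\mathfrak{p})=0$ for all $\mathfrak{p}\in\mathrm{ZL}(R)\setminus\mathrm{Max}(Z(R))$.
   Context: Rings are unital and modules are left modules. $Z(R)$ is the centre of $R$ and $\mathrm{Max}(Z(R))$ its set of maximal ideals. $\mathrm{ZL}(R)=\{P\cap Z(R)\mid P\text{ a prime ideal of }R\}$. $R$ is a PLM-ring if $\mathrm{ann}_R(M)\cap Z(R)\in\mathrm{Max}(Z(R))$ for every simple left $R$-module $M$. For $\mathfrak{p}\in\mathrm{Spec}(Z(R))$, $k(\mathfrak{p})$ is the field of fractions of $Z(R)/\mathfrak{p}$, and $\phi_{\mathfrak{p}}:R/R\mathfrak{p}\to(R/R\mathfrak{p})_{\mathfrak{p}}\simeq k(\mathfrak{p})\otimes_{Z(R)}R/R\mathfrak{p}$, $u\mapsto\frac u1$, is the ring homomorphism to the localization at the central multiplicative set $Z(R)\setminus\mathfrak{p}$. $\mathrm{soc}_R(M)$ is the socle of the $R$-module $M$. *)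

theory Defs
  imports "HOL-Algebra.Ideal_Product" "HOL-Algebra.Generated_Groups" "HOL-Algebra.QuotRing" "HOL-Algebra.Module" "HOL-Library.Poly_Mapping"
begin

section \<open>Centre, ideals and prime spectra of noncommutative rings\<close>

definition centre :: "('a, 'b) ring_scheme \<Rightarrow> 'a set" where
  "centre R = {z \<in> carrier R. \<forall>x \<in> carrier R. z \<otimes>\<^bsub>R\<^esub> x = x \<otimes>\<^bsub>R\<^esub> z}"

definition centre_ring :: "('a, 'b) ring_scheme \<Rightarrow> ('a, 'b) ring_scheme" where
  "centre_ring R = R\<lparr>carrier := centre R\<rparr>"

text \<open>The library locale \<^locale>\<open>primeideal\<close> is restricted to commutative rings, where it asks for
  complete primeness; over a noncommutative ring primeness is a condition on products of ideals.\<close>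

definition prime_ideal_nc :: "('a, 'b) ring_scheme \<Rightarrow> 'a set \<Rightarrow> bool" where
  "prime_ideal_nc R P \<longleftrightarrow> ideal P R \<and> P \<noteq> carrier R \<and>
     (\<forall>I J. ideal I R \<longrightarrow> ideal J R \<longrightarrow> I \<cdot>\<^bsub>R\<^esub> J \<subseteq> P \<longrightarrow> I \<subseteq> P \<or> J \<subseteq> P)"

definition ZL :: "('a, 'b) ring_scheme \<Rightarrow> 'a set set" where
  "ZL R = {P \<inter> centre R |P. prime_ideal_nc R P}"

definition Max_centre :: "('a, 'b) ring_scheme \<Rightarrow> 'a set set" where
  "Max_centre R = {\<mm>. maximalideal \<mm> (centre_ring R)}"

text \<open>\<^const>\<open>ideal_prod\<close> forms all finite nonempty sums of products, also when (as here) the second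
  factor is an ideal of the centre only; so this is the ideal \<open>R\<pp>\<close> of \<open>R\<close>.\<close>

abbreviation extended_ideal :: "('a, 'b) ring_scheme \<Rightarrow> 'a set \<Rightarrow> 'a set" where
  "extended_ideal R \<pp> \<equiv> carrier R \<cdot>\<^bsub>R\<^esub> \<pp>"

abbreviation fibre_ring :: "('a, 'b) ring_scheme \<Rightarrow> 'a set \<Rightarrow> 'a set ring" where
  "fibre_ring R \<pp> \<equiv> R Quot (extended_ideal R \<pp>)"


section \<open>Simple artinian rings\<close>

definition simple_ring :: "('a, 'b) ring_scheme \<Rightarrow> bool" where
  "simple_ring R \<longleftrightarrow> ring R \<and> carrier R \<noteq> {\<zero>\<^bsub>R\<^esub>} \<and>
     (\<forall>I. ideal I R \<longrightarrow> I = {\<zero>\<^bsub>R\<^esub>} \<or> I = carrier R)"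

definition left_ideal :: "'a set \<Rightarrow> ('a, 'b) ring_scheme \<Rightarrow> bool" where
  "left_ideal I R \<longleftrightarrow> additive_subgroup I R \<and> (\<forall>r \<in> carrier R. \<forall>x \<in> I. r \<otimes>\<^bsub>R\<^esub> x \<in> I)"

definition right_ideal :: "'a set \<Rightarrow> ('a, 'b) ring_scheme \<Rightarrow> bool" where
  "right_ideal I R \<longleftrightarrow> additive_subgroup I R \<and> (\<forall>r \<in> carrier R. \<forall>x \<in> I. x \<otimes>\<^bsub>R\<^esub> r \<in> I)"

definition artinian_ring :: "('a, 'b) ring_scheme \<Rightarrow> bool" where
  "artinian_ring R \<longleftrightarrow> ring R \<and>
     (\<forall>I :: nat \<Rightarrow> 'a set. (\<forall>n. left_ideal (I n) R) \<and> antimono I \<longrightarrow> (\<exists>N. \<forall>n\<ge>N. I n = I N)) \<and>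
     (\<forall>I :: nat \<Rightarrow> 'a set. (\<forall>n. right_ideal (I n) R) \<and> antimono I \<longrightarrow> (\<exists>N. \<forall>n\<ge>N. I n = I N))"


section \<open>Left modules\<close>

text \<open>The library locale \<^locale>\<open>module\<close> requires a commutative ring of scalars; its record type and
  its \<^locale>\<open>submodule\<close> do not. The fields \<^term>\<open>mult\<close> and \<^term>\<open>one\<close> which the record type of
  modules inherits from rings play no role here.\<close>

locale left_module = R?: ring R + M?: abelian_group M
  for R :: "('a, 'b) ring_scheme" and M :: "('a, 'c, 'd) module_scheme" (structure) +
  assumes smult_closed:
      "\<lbrakk>a \<in> carrier R; x \<in> carrier M\<rbrakk> \<Longrightarrow> a \<odot>\<^bsub>M\<^esub> x \<in> carrier M"
    and smult_l_distr:
      "\<lbrakk>a \<in> carrier R; b \<in> carrier R; x \<in> carrier M\<rbrakk> \<Longrightarrow>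
       (a \<oplus>\<^bsub>R\<^esub> b) \<odot>\<^bsub>M\<^esub> x = a \<odot>\<^bsub>M\<^esub> x \<oplus>\<^bsub>M\<^esub> b \<odot>\<^bsub>M\<^esub> x"
    and smult_r_distr:
      "\<lbrakk>a \<in> carrier R; x \<in> carrier M; y \<in> carrier M\<rbrakk> \<Longrightarrow>
       a \<odot>\<^bsub>M\<^esub> (x \<oplus>\<^bsub>M\<^esub> y) = a \<odot>\<^bsub>M\<^esub> x \<oplus>\<^bsub>M\<^esub> a \<odot>\<^bsub>M\<^esub> y"
    and smult_assoc1:
      "\<lbrakk>a \<in> carrier R; b \<in> carrier R; x \<in> carrier M\<rbrakk> \<Longrightarrow>
       (a \<otimes>\<^bsub>R\<^esub> b) \<odot>\<^bsub>M\<^esub> x = a \<odot>\<^bsub>M\<^esub> (b \<odot>\<^bsub>M\<^esub> x)"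
    and smult_one:
      "x \<in> carrier M \<Longrightarrow> \<one>\<^bsub>R\<^esub> \<odot>\<^bsub>M\<^esub> x = x"

definition simple_left_module ::
    "('a, 'b) ring_scheme \<Rightarrow> ('a, 'c, 'd) module_scheme \<Rightarrow> bool" where
  "simple_left_module R M \<longleftrightarrow> left_module R M \<and> carrier M \<noteq> {\<zero>\<^bsub>M\<^esub>} \<and>
     (\<forall>N. submodule N R M \<longrightarrow> N = {\<zero>\<^bsub>M\<^esub>} \<or> N = carrier M)"

definition annihilator ::
    "('a, 'b) ring_scheme \<Rightarrow> ('a, 'c, 'd) module_scheme \<Rightarrow> 'a set" where
  "annihilator R M = {r \<in> carrier R. \<forall>x \<in> carrier M. r \<odot>\<^bsub>M\<^esub> x = \<zero>\<^bsub>M\<^esub>}"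

text \<open>The socle is the sum of all simple submodules, i.e. the additive subgroup generated by them;
  it is \<open>{0}\<close> if there are none.\<close>

definition socle ::
    "('a, 'b) ring_scheme \<Rightarrow> ('a, 'c, 'd) module_scheme \<Rightarrow> 'c set" where
  "socle R M = generate (add_monoid M)
     (\<Union>{N. submodule N R M \<and> simple_left_module R (M\<lparr>carrier := N\<rparr>)})"

text \<open>The left \<open>R\<close>-module \<open>R/I\<close>.\<close>

definition quotient_module ::
    "('a, 'b) ring_scheme \<Rightarrow> 'a set \<Rightarrow> ('a, 'a set) module" where
  "quotient_module R I =
     \<lparr>carrier = a_rcosets\<^bsub>R\<^esub> I, mult = rcoset_mult R I, one = I +>\<^bsub>R\<^esub> \<one>\<^bsub>R\<^esub>, zero = I, add = set_add R,
      smult = (\<lambda>r X. \<Union>x\<in>X. I +>\<^bsub>R\<^esub> (r \<otimes>\<^bsub>R\<^esub> x))\<rparr>"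

text \<open>A definition cannot quantify over types, so the simple modules are taken with elements in
  \<^typ>\<open>'a set\<close>. This is no restriction: every simple left module is isomorphic to a module of cosets
  of a left ideal; see the lemma \<open>PLM_ringD\<close> below.\<close>

definition PLM_ring :: "('a, 'b) ring_scheme \<Rightarrow> bool" where
  "PLM_ring R \<longleftrightarrow> ring R \<and>
     (\<forall>M :: ('a, 'a set) module. simple_left_module R M \<longrightarrow>
        annihilator R M \<inter> centre R \<in> Max_centre R)"


section \<open>Localization at a central multiplicative set\<close>

text \<open>\<open>S\<close> is meant to be a multiplicative subset of the centre of \<open>A\<close>; it may contain zero divisors.
  A fraction \<open>a/s\<close> is the class of the pair \<open>(a, s)\<close>.\<close>

definition loc_rel :: "('a, 'b) ring_scheme \<Rightarrow> 'a set \<Rightarrow> (('a \<times> 'a) \<times> ('a \<times> 'a)) set" where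
  "loc_rel A S = {((a, s), (b, t)). a \<in> carrier A \<and> s \<in> S \<and> b \<in> carrier A \<and> t \<in> S \<and>
     (\<exists>u \<in> S. u \<otimes>\<^bsub>A\<^esub> (t \<otimes>\<^bsub>A\<^esub> a) = u \<otimes>\<^bsub>A\<^esub> (s \<otimes>\<^bsub>A\<^esub> b))}"

definition loc_frac :: "('a, 'b) ring_scheme \<Rightarrow> 'a set \<Rightarrow> 'a \<Rightarrow> 'a \<Rightarrow> ('a \<times> 'a) set" where
  "loc_frac A S a s = loc_rel A S `` {(a, s)}"

definition localization :: "('a, 'b) ring_scheme \<Rightarrow> 'a set \<Rightarrow> ('a \<times> 'a) set ring" where
  "localization A S =
     \<lparr>carrier = (carrier A \<times> S) // loc_rel A S,
      mult = (\<lambda>X Y. \<Union>(a, s)\<in>X. \<Union>(b, t)\<in>Y. loc_frac A S (a \<otimes>\<^bsub>A\<^esub> b) (s \<otimes>\<^bsub>A\<^esub> t)),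
      one = loc_frac A S \<one>\<^bsub>A\<^esub> \<one>\<^bsub>A\<^esub>,
      zero = loc_frac A S \<zero>\<^bsub>A\<^esub> \<one>\<^bsub>A\<^esub>,
      add = (\<lambda>X Y. \<Union>(a, s)\<in>X. \<Union>(b, t)\<in>Y.
        loc_frac A S (t \<otimes>\<^bsub>A\<^esub> a \<oplus>\<^bsub>A\<^esub> s \<otimes>\<^bsub>A\<^esub> b) (s \<otimes>\<^bsub>A\<^esub> t))\<rparr>"

text \<open>The image of \<open>Z(R) \<setminus> \<pp>\<close> in \<open>R/R\<pp>\<close>, and the map \<open>u \<mapsto> u/1\<close>.\<close>

definition fibre_denoms :: "('a, 'b) ring_scheme \<Rightarrow> 'a set \<Rightarrow> 'a set set" where
  "fibre_denoms R \<pp> = (\<lambda>z. extended_ideal R \<pp> +>\<^bsub>R\<^esub> z) ` (centre R - \<pp>)"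

definition fibre_localization ::
    "('a, 'b) ring_scheme \<Rightarrow> 'a set \<Rightarrow> ('a set \<times> 'a set) set ring" where
  "fibre_localization R \<pp> = localization (fibre_ring R \<pp>) (fibre_denoms R \<pp>)"

definition phi ::
    "('a, 'b) ring_scheme \<Rightarrow> 'a set \<Rightarrow> 'a set \<Rightarrow> ('a set \<times> 'a set) set" where
  "phi R \<pp> u = loc_frac (fibre_ring R \<pp>) (fibre_denoms R \<pp>) u \<one>\<^bsub>fibre_ring R \<pp>\<^esub>"

text \<open>\<open>k(\<pp>)\<close>, the field of fractions of the domain \<open>Z(R)/\<pp>\<close>, and the canonical map
  \<open>Z(R) \<rightarrow> k(\<pp>)\<close>.\<close>

definition residue_field ::
    "('a, 'b) ring_scheme \<Rightarrow> 'a set \<Rightarrow> ('a set \<times> 'a set) set ring" where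
  "residue_field R \<pp> = (let D = centre_ring R Quot \<pp> in localization D (carrier D - {\<zero>\<^bsub>D\<^esub>}))"

definition to_residue_field ::
    "('a, 'b) ring_scheme \<Rightarrow> 'a set \<Rightarrow> 'a \<Rightarrow> ('a set \<times> 'a set) set" where
  "to_residue_field R \<pp> z = (let D = centre_ring R Quot \<pp> in
     loc_frac D (carrier D - {\<zero>\<^bsub>D\<^esub>}) (\<pp> +>\<^bsub>centre_ring R\<^esub> z) \<one>\<^bsub>D\<^esub>)"


section \<open>Tensor products of algebras\<close>

text \<open>\<open>Z\<close> is a commutative ring and \<open>f: Z \<rightarrow> K\<close>, \<open>g: Z \<rightarrow> A\<close> are ring homomorphisms with central
  images. The tensor product of the \<open>Z\<close>-algebras \<open>K\<close> and \<open>A\<close> is the free abelian group on the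
  pairs \<open>(a, b)\<close>, modulo the subgroup generated by the relations of \<open>Z\<close>-bilinearity, with
  multiplication induced by \<open>(a, b) (c, d) = (ac, bd)\<close>.\<close>

definition free_pair_ring ::
    "('k, 'l) ring_scheme \<Rightarrow> ('a, 'b) ring_scheme \<Rightarrow> (('k \<times> 'a) \<Rightarrow>\<^sub>0 int) ring" where
  "free_pair_ring K A =
     \<lparr>carrier = {x. Poly_Mapping.keys x \<subseteq> carrier K \<times> carrier A},
      mult = (\<lambda>x y. frag_extend (\<lambda>(a, b).
        frag_extend (\<lambda>(c, d). frag_of (a \<otimes>\<^bsub>K\<^esub> c, b \<otimes>\<^bsub>A\<^esub> d)) y) x),
      one = frag_of (\<one>\<^bsub>K\<^esub>, \<one>\<^bsub>A\<^esub>),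
      zero = 0,
      add = (+)\<rparr>"

definition tensor_relations ::
    "('z, 'w) ring_scheme \<Rightarrow> ('k, 'l) ring_scheme \<Rightarrow> ('z \<Rightarrow> 'k) \<Rightarrow>
     ('a, 'b) ring_scheme \<Rightarrow> ('z \<Rightarrow> 'a) \<Rightarrow> (('k \<times> 'a) \<Rightarrow>\<^sub>0 int) set" where
  "tensor_relations Z K f A g =
     {frag_of (a \<oplus>\<^bsub>K\<^esub> a', b) - frag_of (a, b) - frag_of (a', b) |a a' b.
        a \<in> carrier K \<and> a' \<in> carrier K \<and> b \<in> carrier A} \<union>
     {frag_of (a, b \<oplus>\<^bsub>A\<^esub> b') - frag_of (a, b) - frag_of (a, b') |a b b'.
        a \<in> carrier K \<and> b \<in> carrier A \<and> b' \<in> carrier A} \<union>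
     {frag_of (f z \<otimes>\<^bsub>K\<^esub> a, b) - frag_of (a, g z \<otimes>\<^bsub>A\<^esub> b) |z a b.
        z \<in> carrier Z \<and> a \<in> carrier K \<and> b \<in> carrier A}"

definition tensor_ring ::
    "('z, 'w) ring_scheme \<Rightarrow> ('k, 'l) ring_scheme \<Rightarrow> ('z \<Rightarrow> 'k) \<Rightarrow>
     ('a, 'b) ring_scheme \<Rightarrow> ('z \<Rightarrow> 'a) \<Rightarrow> (('k \<times> 'a) \<Rightarrow>\<^sub>0 int) set ring" where
  "tensor_ring Z K f A g = free_pair_ring K A Quot
     generate (add_monoid (free_pair_ring K A)) (tensor_relations Z K f A g)"

text \<open>The ring \<open>k(\<pp>) \<otimes>\<^bsub>Z(R)\<^esub> R/R\<pp>\<close>.\<close>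

definition fibre_tensor ::
    "('a, 'b) ring_scheme \<Rightarrow> 'a set \<Rightarrow> ((('a set \<times> 'a set) set \<times> 'a set) \<Rightarrow>\<^sub>0 int) set ring" where
  "fibre_tensor R \<pp> = tensor_ring (centre_ring R)
     (residue_field R \<pp>) (to_residue_field R \<pp>)
     (fibre_ring R \<pp>) (\<lambda>z. extended_ideal R \<pp> +>\<^bsub>R\<^esub> z)"


section \<open>The PLM property does not depend on the type of the module elements\<close>

lemma (in left_module) smult_r_null:
  assumes "a \<in> carrier R" shows "a \<odot>\<^bsub>M\<^esub> \<zero>\<^bsub>M\<^esub> = \<zero>\<^bsub>M\<^esub>"
proof -
  have "a \<odot>\<^bsub>M\<^esub> \<zero>\<^bsub>M\<^esub> \<oplus>\<^bsub>M\<^esub> a \<odot>\<^bsub>M\<^esub> \<zero>\<^bsub>M\<^esub> = a \<odot>\<^bsub>M\<^esub> \<zero>\<^bsub>M\<^esub> \<oplus>\<^bsub>M\<^esub> \<zero>\<^bsub>M\<^esub>"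
    using smult_r_distr[OF assms, of "\<zero>\<^bsub>M\<^esub>" "\<zero>\<^bsub>M\<^esub>"] smult_closed[OF assms] by simp
  then show ?thesis
    using M.add.r_cancel_one[of "a \<odot>\<^bsub>M\<^esub> \<zero>\<^bsub>M\<^esub>"] smult_closed[OF assms M.zero_closed] by simp
qed

lemma (in left_module) smult_l_null:
  assumes "x \<in> carrier M" shows "\<zero>\<^bsub>R\<^esub> \<odot>\<^bsub>M\<^esub> x = \<zero>\<^bsub>M\<^esub>"
proof -
  have "\<zero>\<^bsub>R\<^esub> \<odot>\<^bsub>M\<^esub> x \<oplus>\<^bsub>M\<^esub> \<zero>\<^bsub>R\<^esub> \<odot>\<^bsub>M\<^esub> x = \<zero>\<^bsub>R\<^esub> \<odot>\<^bsub>M\<^esub> x \<oplus>\<^bsub>M\<^esub> \<zero>\<^bsub>M\<^esub>"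
    using smult_l_distr[of "\<zero>\<^bsub>R\<^esub>" "\<zero>\<^bsub>R\<^esub>" x] smult_closed[of "\<zero>\<^bsub>R\<^esub>" x] assms by simp
  then show ?thesis
    using M.add.r_cancel_one[of "\<zero>\<^bsub>R\<^esub> \<odot>\<^bsub>M\<^esub> x"] smult_closed[OF R.zero_closed assms] by simp
qed

lemma (in left_module) smult_l_minus:
  assumes "a \<in> carrier R" "x \<in> carrier M"
  shows "(\<ominus>\<^bsub>R\<^esub> a) \<odot>\<^bsub>M\<^esub> x = \<ominus>\<^bsub>M\<^esub> (a \<odot>\<^bsub>M\<^esub> x)"
proof -
  have "(\<ominus>\<^bsub>R\<^esub> a) \<odot>\<^bsub>M\<^esub> x \<oplus>\<^bsub>M\<^esub> a \<odot>\<^bsub>M\<^esub> x = \<zero>\<^bsub>M\<^esub>"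
    using smult_l_distr[of "\<ominus>\<^bsub>R\<^esub> a" a x] assms by (simp add: R.l_neg smult_l_null)
  then show ?thesis
    using M.minus_equality smult_closed assms by simp
qed

lemma (in left_module) submodule_cyclic:
  assumes "m \<in> carrier M"
  shows "submodule ((\<lambda>r. r \<odot>\<^bsub>M\<^esub> m) ` carrier R) R M"
proof (intro submodule.intro subgroup.intro submodule_axioms.intro)
  show "(\<lambda>r. r \<odot>\<^bsub>M\<^esub> m) ` carrier R \<subseteq> carrier (add_monoid M)"
    using assms smult_closed by auto
  show "x \<otimes>\<^bsub>add_monoid M\<^esub> y \<in> (\<lambda>r. r \<odot>\<^bsub>M\<^esub> m) ` carrier R"
    if xy: "x \<in> (\<lambda>r. r \<odot>\<^bsub>M\<^esub> m) ` carrier R" "y \<in> (\<lambda>r. r \<odot>\<^bsub>M\<^esub> m) ` carrier R" for x y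
  proof -
    obtain r s where rs: "r \<in> carrier R" "s \<in> carrier R" "x = r \<odot>\<^bsub>M\<^esub> m" "y = s \<odot>\<^bsub>M\<^esub> m"
      using xy by blast
    have "x \<oplus>\<^bsub>M\<^esub> y = (r \<oplus>\<^bsub>R\<^esub> s) \<odot>\<^bsub>M\<^esub> m"
      using rs smult_l_distr assms by simp
    then show ?thesis using rs by simp
  qed
  have "\<zero>\<^bsub>M\<^esub> = \<zero>\<^bsub>R\<^esub> \<odot>\<^bsub>M\<^esub> m" using assms smult_l_null by simp
  then show "\<one>\<^bsub>add_monoid M\<^esub> \<in> (\<lambda>r. r \<odot>\<^bsub>M\<^esub> m) ` carrier R" by simp
  show "inv\<^bsub>add_monoid M\<^esub> x \<in> (\<lambda>r. r \<odot>\<^bsub>M\<^esub> m) ` carrier R"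
    if x: "x \<in> (\<lambda>r. r \<odot>\<^bsub>M\<^esub> m) ` carrier R" for x
  proof -
    obtain r where r: "r \<in> carrier R" "x = r \<odot>\<^bsub>M\<^esub> m" using x by blast
    have "\<ominus>\<^bsub>M\<^esub> x = (\<ominus>\<^bsub>R\<^esub> r) \<odot>\<^bsub>M\<^esub> m" using r assms smult_l_minus by simp
    then show ?thesis using r by (simp add: a_inv_def)
  qed
  show "a \<odot>\<^bsub>M\<^esub> x \<in> (\<lambda>r. r \<odot>\<^bsub>M\<^esub> m) ` carrier R"
    if ax: "a \<in> carrier R" "x \<in> (\<lambda>r. r \<odot>\<^bsub>M\<^esub> m) ` carrier R" for a x
  proof -
    obtain r where r: "r \<in> carrier R" "x = r \<odot>\<^bsub>M\<^esub> m" using ax by blast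
    have "a \<odot>\<^bsub>M\<^esub> x = (a \<otimes>\<^bsub>R\<^esub> r) \<odot>\<^bsub>M\<^esub> m" using r ax assms smult_assoc1 by simp
    then show ?thesis using r ax by simp
  qed
qed

text \<open>Send \<open>x\<close> to the coset \<open>{r. r m = x}\<close> of the annihilator of a nonzero element \<open>m\<close>.\<close>

lemma simple_left_module_transfer:
  fixes R :: "('a, 'b) ring_scheme" and M :: "('a, 'c, 'd) module_scheme"
  assumes simple: "simple_left_module R M"
  obtains M' :: "('a, 'a set) module"
  where "simple_left_module R M'" "annihilator R M' = annihilator R M"
proof -
  interpret M: left_module R M using simple by (simp add: simple_left_module_def)
  have min: "N = {\<zero>\<^bsub>M\<^esub>} \<or> N = carrier M" if "submodule N R M" for N
    using simple that by (simp add: simple_left_module_def)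
  have "carrier M \<noteq> {\<zero>\<^bsub>M\<^esub>}" using simple by (simp add: simple_left_module_def)
  then obtain m where m: "m \<in> carrier M" "m \<noteq> \<zero>\<^bsub>M\<^esub>"
    using M.M.zero_closed by fast
  have "m \<in> (\<lambda>r. r \<odot>\<^bsub>M\<^esub> m) ` carrier R"
    using imageI[OF M.R.one_closed, of "\<lambda>r. r \<odot>\<^bsub>M\<^esub> m"] M.smult_one[OF m(1)] by simp
  then have cyc: "(\<lambda>r. r \<odot>\<^bsub>M\<^esub> m) ` carrier R = carrier M"
    using min[OF M.submodule_cyclic[OF m(1)]] m(2) by (metis singletonD)
  define j where "j = (\<lambda>x. {r \<in> carrier R. r \<odot>\<^bsub>M\<^esub> m = x})"
  have inj: "inj_on j (carrier M)"
  proof (rule inj_onI)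
    fix x y assume xy: "x \<in> carrier M" "y \<in> carrier M" "j x = j y"
    obtain r where r: "r \<in> carrier R" "x = r \<odot>\<^bsub>M\<^esub> m"
      using xy(1) unfolding cyc[symmetric] by (rule imageE)
    then have "r \<in> j x" by (simp add: j_def)
    then have "r \<in> j y" by (simp only: xy(3))
    then show "x = y" using r(2) by (simp add: j_def)
  qed
  define i where "i = inv_into (carrier M) j"
  have ij: "i (j x) = x" if "x \<in> carrier M" for x
    using that inj unfolding i_def by simp
  define M' :: "('a, 'a set) module" where
    "M' = \<lparr>carrier = j ` carrier M, mult = (\<lambda>X Y. X), one = j \<zero>\<^bsub>M\<^esub>, zero = j \<zero>\<^bsub>M\<^esub>,
       add = (\<lambda>X Y. j (i X \<oplus>\<^bsub>M\<^esub> i Y)), smult = (\<lambda>r X. j (r \<odot>\<^bsub>M\<^esub> i X))\<rparr>"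
  have c: "carrier M' = j ` carrier M" and z: "\<zero>\<^bsub>M'\<^esub> = j \<zero>\<^bsub>M\<^esub>"
    by (simp_all add: M'_def)
  have a: "j x \<oplus>\<^bsub>M'\<^esub> j y = j (x \<oplus>\<^bsub>M\<^esub> y)" if "x \<in> carrier M" "y \<in> carrier M" for x y
    using that by (simp add: M'_def ij)
  have s: "r \<odot>\<^bsub>M'\<^esub> j x = j (r \<odot>\<^bsub>M\<^esub> x)" if "x \<in> carrier M" for r x
    using that by (simp add: M'_def ij)
  have "abelian_group M'"
  proof (rule abelian_groupI)
    fix X assume "X \<in> carrier M'"
    then obtain x where x: "x \<in> carrier M" "X = j x" by (auto simp: c)
    then have "j (\<ominus>\<^bsub>M\<^esub> x) \<oplus>\<^bsub>M'\<^esub> X = \<zero>\<^bsub>M'\<^esub>"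
      by (simp add: a z M.M.l_neg)
    then show "\<exists>y\<in>carrier M'. y \<oplus>\<^bsub>M'\<^esub> X = \<zero>\<^bsub>M'\<^esub>" using x by (auto simp: c)
  qed (auto simp: c z a M.M.a_ac)
  moreover have "left_module_axioms R M'"
    by (rule left_module_axioms.intro)
      (auto simp: c z a s M.smult_closed M.smult_l_distr M.smult_r_distr M.smult_assoc1 M.smult_one)
  ultimately have lm: "left_module R M'"
    by (intro left_module.intro) (simp_all add: M.R.ring_axioms)
  interpret M': left_module R M' by (rule lm)
  have neg: "\<ominus>\<^bsub>M'\<^esub> (j x) = j (\<ominus>\<^bsub>M\<^esub> x)" if "x \<in> carrier M" for x
    by (rule M'.M.minus_equality) (use that in \<open>auto simp: c z a M.M.l_neg\<close>)
  have jz: "j x = j \<zero>\<^bsub>M\<^esub> \<longleftrightarrow> x = \<zero>\<^bsub>M\<^esub>" if "x \<in> carrier M" for x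
    using inj that M.M.zero_closed by (auto dest: inj_onD)
  have "N = {\<zero>\<^bsub>M'\<^esub>} \<or> N = carrier M'" if N: "submodule N R M'" for N
  proof -
    interpret N: submodule N R M' by (rule N)
    define K where "K = {x \<in> carrier M. j x \<in> N}"
    have NK: "N = j ` K"
      using N.subset by (auto simp: K_def c)
    have "submodule K R M"
    proof (intro submodule.intro subgroup.intro submodule_axioms.intro)
      show "x \<otimes>\<^bsub>add_monoid M\<^esub> y \<in> K" if "x \<in> K" "y \<in> K" for x y
        using that N.m_closed[of "j x" "j y"] by (simp add: K_def a)
      show "\<one>\<^bsub>add_monoid M\<^esub> \<in> K"
        using N.one_closed by (simp add: K_def z)
      show "inv\<^bsub>add_monoid M\<^esub> x \<in> K" if "x \<in> K" for x
      proof -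
        have "\<ominus>\<^bsub>M'\<^esub> (j x) \<in> N"
          unfolding a_inv_def using that by (intro N.m_inv_closed) (simp add: K_def)
        then have "\<ominus>\<^bsub>M\<^esub> x \<in> K" using that by (simp add: K_def neg)
        then show ?thesis by (simp add: a_inv_def)
      qed
      show "r \<odot>\<^bsub>M\<^esub> x \<in> K" if "r \<in> carrier R" "x \<in> K" for r x
        using that N.smult_closed[of r "j x"] by (simp add: K_def s M.smult_closed)
    qed (auto simp: K_def)
    then have "K = {\<zero>\<^bsub>M\<^esub>} \<or> K = carrier M"
      by (rule min)
    then show ?thesis using NK by (auto simp: c z)
  qed
  moreover have "carrier M' \<noteq> {\<zero>\<^bsub>M'\<^esub>}"
    using m jz[of m] by (auto simp: c z)
  ultimately have "simple_left_module R M'"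
    using lm by (simp add: simple_left_module_def)
  moreover have "annihilator R M' = annihilator R M"
    by (auto simp: annihilator_def c z s jz M.smult_closed)
  ultimately show thesis by (rule that)
qed

lemma PLM_ringD:
  fixes R :: "('a, 'b) ring_scheme" and M :: "('a, 'c, 'd) module_scheme"
  assumes "PLM_ring R" and "simple_left_module R M"
  shows "annihilator R M \<inter> centre R \<in> Max_centre R"
  using assms simple_left_module_transfer[of R M] unfolding PLM_ring_def by metis

end

theory Submission
  imports Defs "HOL-Algebra.Free_Abelian_Groups" "HOL-Algebra.Subrings"
begin

text \<open>Write \<open>J = R\<pp>\<close> and \<open>C = Z(R) \<setminus> \<pp>\<close>. Injectivity of \<open>\<phi>\<^sub>\<pp>\<close> says that every element of \<open>C\<close> is
  regular modulo \<open>J\<close>, and surjectivity then says that every element of \<open>C\<close> is invertible modulo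
  \<open>J\<close>. Every element of \<open>k(\<pp>) \<otimes> R/J\<close> is a fraction \<open>(1/s) \<otimes> a\<close>, which vanishes only if
  \<open>a \<in> J\<close>; hence an ideal strictly above \<open>J\<close> meets \<open>C\<close> (simplicity), and the left ideals above
  \<open>J\<close> that are saturated with respect to \<open>C\<close> satisfy the minimum condition (artinianity).

  (1) implies (3): the annihilator of a simple submodule of \<open>R/J\<close> meets the centre in \<open>\<pp>\<close>, by
  regularity.
  (3) implies (2): if \<open>C\<close> is invertible modulo \<open>J\<close>, all left ideals above \<open>J\<close> are saturated, so
  \<open>R/J\<close> has a minimal left ideal.
  (2) implies (1): if \<open>M\<close> is simple and \<open>\<pp> = ann(M) \<inter> Z(R)\<close> is not maximal, then
  \<open>ann(M) = J\<close> and \<open>C\<close> acts bijectively on \<open>M\<close>. The minimum condition embeds \<open>R/J\<close> into a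
  finite power of \<open>M\<close>, so \<open>C\<close> acts surjectively on \<open>R/J\<close> too and is invertible modulo \<open>J\<close>.\<close>

section \<open>Localization at a central multiplicative set\<close>

lemma Union_const_on:
  assumes "x \<in> X" "\<And>y. y \<in> X \<Longrightarrow> f y = c"
  shows "(\<Union>y\<in>X. f y) = c"
  using assms by blast

text \<open>Used twice: for R/J with the image of \<open>C\<close>, where phi takes its values, and
  for Z(R)/\<pp> with its nonzero elements, whose localization is k(\<pp>). \<open>S\<close> may
  contain zero divisors, so an equality of fractions carries an extra factor from
  \<open>S\<close>.\<close>

locale central_denominators = ring A for A :: "('a, 'b) ring_scheme" (structure) and S +
  assumes denoms_centre: "S \<subseteq> centre A"
    and denoms_one: "\<one> \<in> S"
    and denoms_mult: "\<lbrakk>s \<in> S; t \<in> S\<rbrakk> \<Longrightarrow> s \<otimes> t \<in> S"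
begin

lemma denoms_carrier: "s \<in> S \<Longrightarrow> s \<in> carrier A"
  using denoms_centre by (auto simp: centre_def)

lemma denoms_comm: "\<lbrakk>s \<in> S; x \<in> carrier A\<rbrakk> \<Longrightarrow> s \<otimes> x = x \<otimes> s"
  using denoms_centre by (auto simp: centre_def)

lemma denoms_lcomm:
  assumes "s \<in> S" "x \<in> carrier A" "y \<in> carrier A"
  shows "x \<otimes> (s \<otimes> y) = s \<otimes> (x \<otimes> y)"
  using assms denoms_comm[of s x] denoms_carrier m_assoc by metis

lemmas denoms_simps = denoms_carrier denoms_mult denoms_one denoms_lcomm m_assoc

lemma equiv_loc_rel: "equiv (carrier A \<times> S) (loc_rel A S)"
proof (rule equivI)
  show "loc_rel A S \<subseteq> (carrier A \<times> S) \<times> carrier A \<times> S"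
    by (auto simp: loc_rel_def)
  show "refl_on (carrier A \<times> S) (loc_rel A S)"
    using denoms_one by (auto simp: refl_on_def loc_rel_def)
  show "sym (loc_rel A S)"
    by (auto simp: sym_def loc_rel_def) metis
  show "trans (loc_rel A S)"
  proof (rule transI)
    fix x y z assume "(x, y) \<in> loc_rel A S" "(y, z) \<in> loc_rel A S"
    then obtain a s b t c r u v where eq: "x = (a, s)" "y = (b, t)" "z = (c, r)"
      and mem: "a \<in> carrier A" "s \<in> S" "b \<in> carrier A" "t \<in> S" "c \<in> carrier A" "r \<in> S" "u \<in> S" "v \<in> S"
      and u: "u \<otimes> (t \<otimes> a) = u \<otimes> (s \<otimes> b)" and v: "v \<otimes> (r \<otimes> b) = v \<otimes> (t \<otimes> c)"
      unfolding loc_rel_def by auto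
    \<comment> \<open>The middle denominator \<open>t\<close> joins the witness: it completes a to
      ta, so that the first equation applies, and comes back as tc through the second.\<close>
    have "(u \<otimes> (v \<otimes> t)) \<otimes> (r \<otimes> a) = v \<otimes> (r \<otimes> (u \<otimes> (t \<otimes> a)))"
      using mem by (simp add: denoms_simps)
    also have "\<dots> = u \<otimes> (s \<otimes> (v \<otimes> (r \<otimes> b)))"
      unfolding u using mem by (simp add: denoms_simps)
    also have "\<dots> = (u \<otimes> (v \<otimes> t)) \<otimes> (s \<otimes> c)"
      unfolding v using mem by (simp add: denoms_simps)
    finally show "(x, z) \<in> loc_rel A S"
      using mem by (auto simp: loc_rel_def eq intro!: bexI[of _ "u \<otimes> (v \<otimes> t)"] denoms_mult)
  qed
qed

lemma loc_frac_eq_iff: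
  assumes "a \<in> carrier A" "s \<in> S" "b \<in> carrier A" "t \<in> S"
  shows "loc_frac A S a s = loc_frac A S b t \<longleftrightarrow> (\<exists>u\<in>S. u \<otimes> (t \<otimes> a) = u \<otimes> (s \<otimes> b))"
proof -
  have "loc_frac A S a s = loc_frac A S b t \<longleftrightarrow> ((a, s), (b, t)) \<in> loc_rel A S"
    unfolding loc_frac_def using assms by (intro eq_equiv_class_iff[OF equiv_loc_rel]) auto
  then show ?thesis using assms by (auto simp: loc_rel_def)
qed

lemma loc_frac_eqI:
  assumes "a \<in> carrier A" "s \<in> S" "b \<in> carrier A" "t \<in> S" "t \<otimes> a = s \<otimes> b"
  shows "loc_frac A S a s = loc_frac A S b t"
  using assms denoms_one by (auto simp: loc_frac_eq_iff)

lemma mem_loc_frac: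
  assumes "a \<in> carrier A" "s \<in> S"
  shows "(a, s) \<in> loc_frac A S a s"
  unfolding loc_frac_def using assms equiv_class_self[OF equiv_loc_rel] by blast

lemma loc_fracD:
  assumes "(b, t) \<in> loc_frac A S a s"
  shows "b \<in> carrier A" "t \<in> S" "\<exists>u\<in>S. u \<otimes> (t \<otimes> a) = u \<otimes> (s \<otimes> b)"
  using assms by (auto simp: loc_frac_def loc_rel_def)

lemma loc_frac_closed:
  "\<lbrakk>a \<in> carrier A; s \<in> S\<rbrakk> \<Longrightarrow> loc_frac A S a s \<in> carrier (localization A S)"
  by (auto simp: localization_def loc_frac_def intro: quotientI)

lemma localization_cases:
  assumes "x \<in> carrier (localization A S)"
  obtains a s where "a \<in> carrier A" "s \<in> S" "x = loc_frac A S a s"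
  using assms unfolding localization_def by (auto simp: loc_frac_def elim!: quotientE)

text \<open>Multiplication is a union over all pairs of representatives. Any two pairs give the same
  fraction, the product of the two given witnesses being a witness, so the union collapses to that
  fraction. Addition is treated in the same way below.\<close>

lemma loc_frac_mult:
  assumes mem: "a \<in> carrier A" "s \<in> S" "b \<in> carrier A" "t \<in> S"
  shows "loc_frac A S a s \<otimes>\<^bsub>localization A S\<^esub> loc_frac A S b t = loc_frac A S (a \<otimes> b) (s \<otimes> t)"
proof -
  have "loc_frac A S (a' \<otimes> b') (s' \<otimes> t') = loc_frac A S (a \<otimes> b) (s \<otimes> t)"
    if ab: "(a', s') \<in> loc_frac A S a s" "(b', t') \<in> loc_frac A S b t" for a' s' b' t'
  proof -
    note mem' = loc_fracD(1,2)[OF ab(1)] loc_fracD(1,2)[OF ab(2)]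
    obtain u v where uv: "u \<in> S" "v \<in> S"
      and u: "u \<otimes> (s' \<otimes> a) = u \<otimes> (s \<otimes> a')" and v: "v \<otimes> (t' \<otimes> b) = v \<otimes> (t \<otimes> b')"
      using loc_fracD(3)[OF ab(1)] loc_fracD(3)[OF ab(2)] by blast
    have "(u \<otimes> v) \<otimes> ((s' \<otimes> t') \<otimes> (a \<otimes> b)) = (u \<otimes> (s' \<otimes> a)) \<otimes> (v \<otimes> (t' \<otimes> b))"
      using mem mem' uv denoms_lcomm[of v a] denoms_lcomm[of t' a] by (simp add: denoms_simps)
    also have "\<dots> = (u \<otimes> v) \<otimes> ((s \<otimes> t) \<otimes> (a' \<otimes> b'))"
      unfolding u v
      using mem mem' uv denoms_lcomm[of v a'] denoms_lcomm[of t a'] by (simp add: denoms_simps)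
    finally show ?thesis
      using mem mem' uv
      by (intro sym[OF loc_frac_eq_iff[THEN iffD2]] bexI[of _ "u \<otimes> v"])
         (simp_all add: denoms_mult denoms_carrier)
  qed
  then show ?thesis
    unfolding localization_def
    by (auto intro!: Union_const_on[OF mem_loc_frac[OF mem(1,2)]]
        Union_const_on[OF mem_loc_frac[OF mem(3,4)]])
qed

lemma loc_frac_add:
  assumes mem: "a \<in> carrier A" "s \<in> S" "b \<in> carrier A" "t \<in> S"
  shows "loc_frac A S a s \<oplus>\<^bsub>localization A S\<^esub> loc_frac A S b t =
    loc_frac A S (t \<otimes> a \<oplus> s \<otimes> b) (s \<otimes> t)"
proof -
  have "loc_frac A S (t' \<otimes> a' \<oplus> s' \<otimes> b') (s' \<otimes> t') = loc_frac A S (t \<otimes> a \<oplus> s \<otimes> b) (s \<otimes> t)"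
    if ab: "(a', s') \<in> loc_frac A S a s" "(b', t') \<in> loc_frac A S b t" for a' s' b' t'
  proof -
    note mem' = loc_fracD(1,2)[OF ab(1)] loc_fracD(1,2)[OF ab(2)]
    obtain u v where uv: "u \<in> S" "v \<in> S"
      and u: "u \<otimes> (s' \<otimes> a) = u \<otimes> (s \<otimes> a')" and v: "v \<otimes> (t' \<otimes> b) = v \<otimes> (t \<otimes> b')"
      using loc_fracD(3)[OF ab(1)] loc_fracD(3)[OF ab(2)] by blast
    have "(u \<otimes> v) \<otimes> ((s' \<otimes> t') \<otimes> (t \<otimes> a \<oplus> s \<otimes> b)) =
        v \<otimes> (t' \<otimes> (t \<otimes> (u \<otimes> (s' \<otimes> a)))) \<oplus> u \<otimes> (s \<otimes> (s' \<otimes> (v \<otimes> (t' \<otimes> b))))"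
      using mem mem' uv by (simp add: denoms_simps r_distr)
    also have "\<dots> = (u \<otimes> v) \<otimes> ((s \<otimes> t) \<otimes> (t' \<otimes> a' \<oplus> s' \<otimes> b'))"
      unfolding u v using mem mem' uv by (simp add: denoms_simps r_distr)
    finally show ?thesis
      using mem mem' uv
      by (intro sym[OF loc_frac_eq_iff[THEN iffD2]] bexI[of _ "u \<otimes> v"])
         (simp_all add: denoms_mult denoms_carrier)
  qed
  then show ?thesis
    unfolding localization_def
    by (auto intro!: Union_const_on[OF mem_loc_frac[OF mem(1,2)]]
        Union_const_on[OF mem_loc_frac[OF mem(3,4)]])
qed

lemma localization_one: "\<one>\<^bsub>localization A S\<^esub> = loc_frac A S \<one> \<one>"
  and localization_zero: "\<zero>\<^bsub>localization A S\<^esub> = loc_frac A S \<zero> \<one>"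
  by (simp_all add: localization_def)

text \<open>This group is the target of the homomorphism out of the free abelian group that detects
  zero in the tensor product, in \<open>fraction_zeroD\<close>.\<close>

lemma abelian_group_localization: "abelian_group (localization A S)"
proof (rule abelian_groupI)
  let ?L = "localization A S"
  show "\<zero>\<^bsub>?L\<^esub> \<in> carrier ?L"
    by (simp add: localization_zero loc_frac_closed denoms_one)
  fix x assume "x \<in> carrier ?L"
  then obtain a s where x: "a \<in> carrier A" "s \<in> S" "x = loc_frac A S a s"
    by (rule localization_cases)
  show "\<zero>\<^bsub>?L\<^esub> \<oplus>\<^bsub>?L\<^esub> x = x"
    using x by (simp add: localization_zero loc_frac_add denoms_one denoms_carrier)
  have "loc_frac A S (\<ominus> a) s \<oplus>\<^bsub>?L\<^esub> x = \<zero>\<^bsub>?L\<^esub>"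
    using x unfolding localization_zero
    by (simp add: loc_frac_add denoms_one denoms_carrier r_minus l_neg)
       (rule loc_frac_eqI, simp_all add: denoms_simps)
  then show "\<exists>y\<in>carrier ?L. y \<oplus>\<^bsub>?L\<^esub> x = \<zero>\<^bsub>?L\<^esub>"
    using x by (intro bexI[of _ "loc_frac A S (\<ominus> a) s"]) (simp_all add: loc_frac_closed)
  fix y assume "y \<in> carrier ?L"
  then obtain b t where y: "b \<in> carrier A" "t \<in> S" "y = loc_frac A S b t"
    by (rule localization_cases)
  show "x \<oplus>\<^bsub>?L\<^esub> y \<in> carrier ?L"
    using x y by (auto simp: loc_frac_add denoms_simps intro!: loc_frac_closed)
  show "x \<oplus>\<^bsub>?L\<^esub> y = y \<oplus>\<^bsub>?L\<^esub> x"
    using x y by (simp add: loc_frac_add denoms_carrier a_comm denoms_comm)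
  fix z assume "z \<in> carrier ?L"
  then obtain c r where z: "c \<in> carrier A" "r \<in> S" "z = loc_frac A S c r"
    by (rule localization_cases)
  show "x \<oplus>\<^bsub>?L\<^esub> y \<oplus>\<^bsub>?L\<^esub> z = x \<oplus>\<^bsub>?L\<^esub> (y \<oplus>\<^bsub>?L\<^esub> z)"
    using x y z by (simp add: loc_frac_add denoms_simps r_distr a_assoc)
qed

lemma loc_frac_add_same:
  assumes mem: "a \<in> carrier A" "b \<in> carrier A" "s \<in> S"
  shows "loc_frac A S a s \<oplus>\<^bsub>localization A S\<^esub> loc_frac A S b s = loc_frac A S (a \<oplus> b) s"
  using assms by (simp add: loc_frac_add)
    (rule loc_frac_eqI, simp_all add: denoms_simps r_distr)

end

section \<open>The fibre over a prime of the centre\<close>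

lemma (in ring) subcring_centre: "subcring (centre R) R"
proof (intro subcringI subringI)
  fix x y assume xy: "x \<in> centre R" "y \<in> centre R"
  then have c: "x \<in> carrier R" "y \<in> carrier R" by (auto simp: centre_def)
  have comm: "x \<otimes> r = r \<otimes> x" "y \<otimes> r = r \<otimes> y" if "r \<in> carrier R" for r
    using xy that by (auto simp: centre_def)
  show "\<ominus> x \<in> centre R" using c comm by (simp add: centre_def l_minus r_minus)
  show "x \<oplus> y \<in> centre R" using c comm by (simp add: centre_def l_distr r_distr)
  have "(x \<otimes> y) \<otimes> r = r \<otimes> (x \<otimes> y)" if r: "r \<in> carrier R" for r
    using c r comm(2)[OF r] comm(1)[OF r] by (metis m_assoc)
  then show "x \<otimes> y \<in> centre R" using c by (simp add: centre_def)
  show "x \<otimes> y = y \<otimes> x" using c comm(1)[of y] by blast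
qed (auto simp: centre_def)

text \<open>Elements i of \<open>I\<close> are central, so (r i) s = (r s) i, which makes the left
  ideal generated by \<open>I\<close> two-sided. Negatives come from multiplication by -1, and an
  element of \<open>I\<close> provides zero.\<close>

lemma (in ring) ideal_extended_ideal:
  assumes "I \<subseteq> centre R" "I \<noteq> {}"
  shows "ideal (extended_ideal R I) R"
proof -
  have central: "z \<in> carrier R" "z \<otimes> r = r \<otimes> z" if "z \<in> I" "r \<in> carrier R" for z r
    using assms that by (auto simp: centre_def)
  have Ic: "z \<in> carrier R" if "z \<in> I" for z
    using assms that by (auto simp: centre_def)
  have sub: "x \<in> carrier R" if "x \<in> extended_ideal R I" for x
    using that by (induction rule: ideal_prod.induct) (auto simp: Ic)
  have left: "r \<otimes> x \<in> extended_ideal R I" if "x \<in> extended_ideal R I" "r \<in> carrier R" for r x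
    using that
  proof (induction rule: ideal_prod.induct)
    case (prod i j)
    then have "r \<otimes> (i \<otimes> j) = (r \<otimes> i) \<otimes> j" by (simp add: m_assoc Ic)
    then show ?case using prod by (auto intro: ideal_prod.prod)
  next
    case (sum s1 s2)
    then have "r \<otimes> (s1 \<oplus> s2) = r \<otimes> s1 \<oplus> r \<otimes> s2" by (simp add: r_distr sub)
    then show ?case using sum by (auto intro: ideal_prod.sum)
  qed
  have right: "x \<otimes> r \<in> extended_ideal R I" if "x \<in> extended_ideal R I" "r \<in> carrier R" for r x
    using that
  proof (induction rule: ideal_prod.induct)
    case (prod i j)
    then have "(i \<otimes> j) \<otimes> r = (i \<otimes> r) \<otimes> j" using central(2)[of j r] by (simp add: m_assoc Ic)
    then show ?case using prod by (auto intro: ideal_prod.prod)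
  next
    case (sum s1 s2)
    then have "(s1 \<oplus> s2) \<otimes> r = s1 \<otimes> r \<oplus> s2 \<otimes> r" by (simp add: l_distr sub)
    then show ?case using sum by (auto intro: ideal_prod.sum)
  qed
  have minus: "\<ominus> x \<in> extended_ideal R I" if "x \<in> extended_ideal R I" for x
    using left[OF that, of "\<ominus> \<one>"] sub[OF that] by (simp add: l_minus)
  obtain z where "z \<in> I" using assms by blast
  then have "\<zero> \<otimes> z \<in> extended_ideal R I" by (intro ideal_prod.prod) auto
  then have zero: "\<zero> \<in> extended_ideal R I" using \<open>z \<in> I\<close> by (simp add: Ic)
  show ?thesis
  proof (rule idealI)
    show "subgroup (extended_ideal R I) (add_monoid R)"
      using sub zero minus by (intro subgroup.intro) (auto simp: a_inv_def intro: ideal_prod.sum)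
  qed (use left right in \<open>auto intro: ring_axioms\<close>)
qed

text \<open>Primeness concerns products of ideals, so z and w are replaced by residuals modulo
  \<open>P\<close>: \<open>J\<close> collects the x with xz in \<open>P\<close> and is two-sided
  because z is central; \<open>I\<close> collects the x with xJ inside \<open>P\<close>. Then IJ
  lies in \<open>P\<close>, while w is in \<open>J\<close>, and z is in \<open>I\<close> since zy =
  yz for y in \<open>J\<close>.\<close>

lemma prime_ideal_nc_central_mult:
  fixes R (structure)
  assumes "ring R" and P: "prime_ideal_nc R P"
    and zw: "z \<in> centre R" "w \<in> centre R" "z \<otimes>\<^bsub>R\<^esub> w \<in> P"
  shows "z \<in> P \<or> w \<in> P"
proof -
  interpret ring R by fact
  interpret P: ideal P R using P by (simp add: prime_ideal_nc_def)
  have c: "z \<in> carrier R" "w \<in> carrier R"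
    using zw(1,2) unfolding centre_def by blast+
  have z: "z \<otimes> r = r \<otimes> z" if "r \<in> carrier R" for r
    using zw(1) that unfolding centre_def by blast
  define J where "J = {x \<in> carrier R. x \<otimes> z \<in> P}"
  define I where "I = {x \<in> carrier R. \<forall>y\<in>J. x \<otimes> y \<in> P}"
  have J: "ideal J R"
  proof (intro idealI subgroup.intro)
    fix a x assume ax: "a \<in> J" "x \<in> carrier R"
    have "(a \<otimes> x) \<otimes> z = (a \<otimes> z) \<otimes> x"
      using ax z[of x] c by (simp add: J_def m_assoc)
    then show "a \<otimes> x \<in> J" using ax c by (simp add: J_def P.I_r_closed)
    show "x \<otimes> a \<in> J" using ax c by (simp add: J_def P.I_l_closed m_assoc)
  qed (use c in \<open>auto simp: J_def l_distr l_minus ring_axioms simp flip: a_inv_def\<close>)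
  interpret J: ideal J R by (rule J)
  have I: "ideal I R"
  proof (intro idealI subgroup.intro)
    fix a x assume ax: "a \<in> I" "x \<in> carrier R"
    then show "a \<otimes> x \<in> I" "x \<otimes> a \<in> I"
      by (auto simp: I_def m_assoc P.I_l_closed J.I_l_closed)
  qed (auto simp: I_def l_distr l_minus ring_axioms simp flip: a_inv_def)
  have "x \<in> P" if "x \<in> I \<cdot>\<^bsub>R\<^esub> J" for x
    using that by (induction rule: ideal_prod.induct) (auto simp: I_def)
  then have "I \<subseteq> P \<or> J \<subseteq> P"
    using P I J by (auto simp: prime_ideal_nc_def)
  moreover have "w \<in> J"
    unfolding J_def using zw(3)[unfolded z[OF c(2)]] c(2) by blast
  moreover have "z \<in> I"
    unfolding I_def
  proof (intro CollectI conjI ballI c)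
    fix y assume "y \<in> J"
    then have y: "y \<in> carrier R" "y \<otimes> z \<in> P" unfolding J_def by blast+
    then show "z \<otimes> y \<in> P" unfolding z[OF y(1)] by blast
  qed
  ultimately show ?thesis by blast
qed

locale central_prime = ring R for R :: "('a, 'b) ring_scheme" (structure) and \<pp> +
  assumes in_ZL: "\<pp> \<in> ZL R"
begin

abbreviation "J \<equiv> extended_ideal R \<pp>"
abbreviation "C \<equiv> centre R - \<pp>"
abbreviation "g \<equiv> (\<lambda>r. J +> r)"
abbreviation "A \<equiv> fibre_ring R \<pp>"
abbreviation "S \<equiv> fibre_denoms R \<pp>"

lemma centre_carrier: "z \<in> centre R \<Longrightarrow> z \<in> carrier R"
  by (simp add: centre_def)

lemma centre_comm: "\<lbrakk>z \<in> centre R; r \<in> carrier R\<rbrakk> \<Longrightarrow> z \<otimes> r = r \<otimes> z"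
  by (simp add: centre_def)

lemma in_ZLE:
  obtains P where "prime_ideal_nc R P" "\<pp> = P \<inter> centre R"
  using in_ZL by (auto simp: ZL_def)

lemma prime_subset_centre: "\<pp> \<subseteq> centre R"
  by (rule in_ZLE) auto

lemma zero_in_prime: "\<zero> \<in> \<pp>"
proof (rule in_ZLE)
  fix P assume "prime_ideal_nc R P" "\<pp> = P \<inter> centre R"
  then show ?thesis
    by (auto simp: prime_ideal_nc_def centre_def additive_subgroup.zero_closed ideal.axioms(1))
qed

sublocale J: ideal J R
  using ideal_extended_ideal prime_subset_centre zero_in_prime by blast

sublocale g: ring_hom_ring R A g
  by (rule J.rcos_ring_hom_ring)

sublocale Z: cring "centre_ring R"
  using subcring_centre subcring_iff[of "centre R"] unfolding centre_ring_def by (auto simp: centre_def)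

lemma centre_ring_simps [simp]:
  "carrier (centre_ring R) = centre R" "\<zero>\<^bsub>centre_ring R\<^esub> = \<zero>" "\<one>\<^bsub>centre_ring R\<^esub> = \<one>"
  "x \<oplus>\<^bsub>centre_ring R\<^esub> y = x \<oplus> y" "x \<otimes>\<^bsub>centre_ring R\<^esub> y = x \<otimes> y"
  by (simp_all add: centre_ring_def)

lemma centre_ring_a_inv: "x \<in> centre R \<Longrightarrow> \<ominus>\<^bsub>centre_ring R\<^esub> x = \<ominus> x"
  using Z.l_neg[of x] Z.a_inv_closed[of x] centre_carrier
  by (intro sym[OF minus_equality]) auto

sublocale p: ideal \<pp> "centre_ring R"
proof (rule in_ZLE)
  fix P assume P: "prime_ideal_nc R P" "\<pp> = P \<inter> centre R"
  then interpret P: ideal P R by (simp add: prime_ideal_nc_def)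
  show "ideal \<pp> (centre_ring R)"
  proof (rule idealI[OF Z.ring_axioms])
    show "subgroup \<pp> (add_monoid (centre_ring R))"
    proof (rule subgroup.intro)
      fix x assume "x \<in> \<pp>"
      then have "\<ominus>\<^bsub>centre_ring R\<^esub> x \<in> \<pp>"
        using P(2) centre_ring_a_inv[of x] Z.a_inv_closed[of x] by simp
      then show "inv\<^bsub>add_monoid (centre_ring R)\<^esub> x \<in> \<pp>" by (simp only: a_inv_def)
    qed (use P(2) Z.zero_closed Z.a_closed in auto)
  next
    fix a x assume "a \<in> \<pp>" "x \<in> carrier (centre_ring R)"
    then show "x \<otimes>\<^bsub>centre_ring R\<^esub> a \<in> \<pp>" "a \<otimes>\<^bsub>centre_ring R\<^esub> x \<in> \<pp>"
      using P(2) Z.m_closed P.I_l_closed P.I_r_closed centre_carrier by auto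
  qed
qed

text \<open>Write \<pp> as P \<inter> Z(R) with P a prime ideal of R. Being an ideal that contains
  \<pp>, P contains \<open>J\<close>, so \<open>J\<close> cannot meet the centre outside
  \<pp>.\<close>

lemma extended_inter_centre: "J \<inter> centre R = \<pp>"
proof (rule in_ZLE)
  fix P assume P: "prime_ideal_nc R P" "\<pp> = P \<inter> centre R"
  then interpret P: ideal P R by (simp add: prime_ideal_nc_def)
  have "x \<in> P" if "x \<in> J" for x
    using that by (induction rule: ideal_prod.induct) (auto simp: P(2) P.I_l_closed)
  moreover have "z \<in> J" if "z \<in> \<pp>" for z
    using ideal_prod.prod[of \<one> "carrier R" z \<pp> R] that prime_subset_centre centre_carrier by auto
  ultimately show ?thesis using P(2) by auto
qed

lemma one_in_C: "\<one> \<in> C"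
proof (rule in_ZLE)
  fix P assume P: "prime_ideal_nc R P" "\<pp> = P \<inter> centre R"
  then have "ideal P R" "P \<noteq> carrier R" by (simp_all add: prime_ideal_nc_def)
  then have "\<one> \<notin> P" using ideal.one_imp_carrier by blast
  then show ?thesis using P Z.one_closed by auto
qed

lemma C_mult: "\<lbrakk>c \<in> C; d \<in> C\<rbrakk> \<Longrightarrow> c \<otimes> d \<in> C"
  by (rule in_ZLE) (use prime_ideal_nc_central_mult[OF ring_axioms] Z.m_closed in auto)

lemma C_carrier: "c \<in> C \<Longrightarrow> c \<in> carrier R"
  by (simp add: centre_carrier)

lemma carrier_A: "carrier A = g ` carrier R"
  unfolding FactRing_def A_RCOSETS_def' partial_object.simps by blast

lemma g_eq_iff:
  assumes "a \<in> carrier R" "b \<in> carrier R"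
  shows "g a = g b \<longleftrightarrow> a \<ominus> b \<in> J"
  using quotient_eq_iff_same_a_r_cos[OF J.ideal_axioms assms] by (rule sym)

lemma g_eq_zero_iff: "a \<in> carrier R \<Longrightarrow> g a = \<zero>\<^bsub>A\<^esub> \<longleftrightarrow> a \<in> J"
  using g_eq_iff[of a \<zero>] g.hom_zero by (simp add: a_minus_def)

sublocale A: central_denominators A S
proof (intro central_denominators.intro central_denominators_axioms.intro)
  show "ring A" by (rule J.quotient_is_ring)
  show "S \<subseteq> centre A"
  proof
    fix x assume "x \<in> S"
    then obtain c where c: "c \<in> C" "x = g c" unfolding fibre_denoms_def by blast
    have "g c \<otimes>\<^bsub>A\<^esub> g r = g r \<otimes>\<^bsub>A\<^esub> g c" if "r \<in> carrier R" for r
      using c that C_carrier[of c] centre_comm[of c r] g.hom_mult[of c r] g.hom_mult[of r c]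
      by (metis DiffD1)
    then show "x \<in> centre A"
      using c C_carrier[of c] by (simp add: centre_def carrier_A)
  qed
  show "\<one>\<^bsub>A\<^esub> \<in> S"
    using one_in_C g.hom_one unfolding fibre_denoms_def by (metis imageI)
  fix s t assume "s \<in> S" "t \<in> S"
  then obtain c d where "c \<in> C" "d \<in> C" "s = g c" "t = g d"
    unfolding fibre_denoms_def by blast
  then show "s \<otimes>\<^bsub>A\<^esub> t \<in> S"
    using C_mult[of c d] C_carrier g.hom_mult[of c d] unfolding fibre_denoms_def by (metis imageI)
qed

end

section \<open>Regularity and invertibility of \<open>C\<close> modulo \<open>J\<close>\<close>

locale torsion_free_fibre = central_prime +
  assumes inj_phi: "inj_on (phi R \<pp>) (carrier (fibre_ring R \<pp>))"
begin

text \<open>The class of c is an admissible witness in the localization: if cr is in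
  \<open>J\<close>, the fractions of \<open>g r\<close> and of zero agree, and injectivity of phi
  makes \<open>g r\<close> zero.\<close>

lemma C_regular:
  assumes c: "c \<in> C" and r: "r \<in> carrier R" and cr: "c \<otimes> r \<in> J"
  shows "r \<in> J"
proof -
  have "g c \<otimes>\<^bsub>A\<^esub> g r = \<zero>\<^bsub>A\<^esub>"
    using c r cr C_carrier g_eq_zero_iff[of "c \<otimes> r"] by (simp add: g.hom_mult)
  moreover have "g c \<in> S" using c by (simp add: fibre_denoms_def)
  ultimately have "phi R \<pp> (g r) = phi R \<pp> \<zero>\<^bsub>A\<^esub>"
    unfolding phi_def using r c C_carrier
    by (subst A.loc_frac_eq_iff) (auto simp: A.denoms_one intro!: bexI[of _ "g c"])
  then have "g r = \<zero>\<^bsub>A\<^esub>"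
    using inj_phi r g.hom_closed[of r] J.quotient_is_ring ring.ring_simprules(2) by (metis inj_onD)
  then show ?thesis using r g_eq_zero_iff by simp
qed

text \<open>If \<open>g r\<close> is a preimage of 1/c, then d(1 - cr) is in \<open>J\<close> for
  some d in \<open>C\<close>, and \<open>C_regular\<close> removes d. Conversely, if r inverts c
  modulo \<open>J\<close>, then a/c is the image of ra.\<close>

lemma phi_surj_iff:
  "phi R \<pp> ` carrier A = carrier (fibre_localization R \<pp>) \<longleftrightarrow>
    (\<forall>c\<in>C. \<exists>r\<in>carrier R. \<one> \<ominus> c \<otimes> r \<in> J)"
proof
  assume surj: "phi R \<pp> ` carrier A = carrier (fibre_localization R \<pp>)"
  show "\<forall>c\<in>C. \<exists>r\<in>carrier R. \<one> \<ominus> c \<otimes> r \<in> J"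
  proof
    fix c assume c: "c \<in> C"
    have gc: "g c \<in> S" using c by (simp add: fibre_denoms_def)
    then have "loc_frac A S \<one>\<^bsub>A\<^esub> (g c) \<in> phi R \<pp> ` carrier A"
      unfolding surj fibre_localization_def by (intro A.loc_frac_closed) auto
    then obtain r where r: "r \<in> carrier R" "loc_frac A S \<one>\<^bsub>A\<^esub> (g c) = loc_frac A S (g r) \<one>\<^bsub>A\<^esub>"
      unfolding phi_def carrier_A by auto
    then have "\<exists>u\<in>S. u \<otimes>\<^bsub>A\<^esub> (\<one>\<^bsub>A\<^esub> \<otimes>\<^bsub>A\<^esub> \<one>\<^bsub>A\<^esub>) = u \<otimes>\<^bsub>A\<^esub> (g c \<otimes>\<^bsub>A\<^esub> g r)"
      using gc A.denoms_one A.loc_frac_eq_iff[of "\<one>\<^bsub>A\<^esub>" "g c" "g r" "\<one>\<^bsub>A\<^esub>"] by simp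
    then obtain d where d: "d \<in> C" and "g d \<otimes>\<^bsub>A\<^esub> (\<one>\<^bsub>A\<^esub> \<otimes>\<^bsub>A\<^esub> \<one>\<^bsub>A\<^esub>) = g d \<otimes>\<^bsub>A\<^esub> (g c \<otimes>\<^bsub>A\<^esub> g r)"
      unfolding fibre_denoms_def by blast
    then have "g (d \<otimes> \<one>) = g (d \<otimes> (c \<otimes> r))"
      using r c C_carrier by (simp add: g.hom_mult)
    then have "d \<otimes> \<one> \<ominus> d \<otimes> (c \<otimes> r) \<in> J"
      using r c d C_carrier by (intro iffD1[OF g_eq_iff] m_closed) simp_all
    also have "d \<otimes> \<one> \<ominus> d \<otimes> (c \<otimes> r) = d \<otimes> (\<one> \<ominus> c \<otimes> r)"
      using r c d C_carrier by (simp add: a_minus_def r_distr r_minus)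
    finally have "\<one> \<ominus> c \<otimes> r \<in> J"
      by (rule C_regular[OF d, rotated]) (use r(1) C_carrier[OF c] in auto)
    then show "\<exists>r\<in>carrier R. \<one> \<ominus> c \<otimes> r \<in> J" using r by blast
  qed
next
  assume inv: "\<forall>c\<in>C. \<exists>r\<in>carrier R. \<one> \<ominus> c \<otimes> r \<in> J"
  have "x \<in> phi R \<pp> ` carrier A" if x: "x \<in> carrier (localization A S)" for x
  proof -
    obtain a' s' where "a' \<in> carrier A" "s' \<in> S" "x = loc_frac A S a' s'"
      using x by (rule A.localization_cases)
    then obtain a c where ac: "a \<in> carrier R" "c \<in> C" "x = loc_frac A S (g a) (g c)"
      unfolding carrier_A fibre_denoms_def by blast
    then obtain r where r: "r \<in> carrier R" "\<one> \<ominus> c \<otimes> r \<in> J" using inv by blast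
    then have "g c \<otimes>\<^bsub>A\<^esub> g r = \<one>\<^bsub>A\<^esub>"
      using ac C_carrier g_eq_iff[of \<one> "c \<otimes> r"] g.hom_one by (simp add: g.hom_mult)
    then have "g c \<otimes>\<^bsub>A\<^esub> (g r \<otimes>\<^bsub>A\<^esub> g a) = \<one>\<^bsub>A\<^esub> \<otimes>\<^bsub>A\<^esub> g a"
      using ac r C_carrier g.S.m_assoc[of "g c" "g r" "g a"] by simp
    then have "x = phi R \<pp> (g r \<otimes>\<^bsub>A\<^esub> g a)"
      unfolding ac(3) phi_def using ac r C_carrier
      by (intro A.loc_frac_eqI) (auto simp: fibre_denoms_def A.denoms_one[unfolded fibre_denoms_def])
    then show ?thesis using ac r by auto
  qed
  then show "phi R \<pp> ` carrier A = carrier (fibre_localization R \<pp>)"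
    by (auto simp: fibre_localization_def phi_def A.loc_frac_closed A.denoms_one)
qed

end

section \<open>Fractions in the tensor product with the residue field\<close>

lemma keys_diff3:
  assumes "x \<in> X" "y \<in> X" "z \<in> X"
  shows "Poly_Mapping.keys (frag_of x - frag_of y - frag_of z) \<subseteq> X"
    "Poly_Mapping.keys (frag_of x - frag_of y) \<subseteq> X"
proof -
  have k: "Poly_Mapping.keys (frag_of x - frag_of y) \<subseteq> X"
    using keys_diff[of "frag_of x" "frag_of y"] assms by (auto simp: keys_frag_of)
  then show "Poly_Mapping.keys (frag_of x - frag_of y) \<subseteq> X" .
  show "Poly_Mapping.keys (frag_of x - frag_of y - frag_of z) \<subseteq> X"
    using keys_diff[of "frag_of x - frag_of y" "frag_of z"] k assms
    by (auto simp: keys_frag_of)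
qed

context torsion_free_fibre
begin

abbreviation "D \<equiv> centre_ring R Quot \<pp>"
abbreviation "E \<equiv> carrier D - {\<zero>\<^bsub>D\<^esub>}"
abbreviation "h \<equiv> (\<lambda>z. \<pp> +>\<^bsub>centre_ring R\<^esub> z)"
abbreviation "K \<equiv> residue_field R \<pp>"
abbreviation "F \<equiv> free_pair_ring K A"
abbreviation "N \<equiv> generate (add_monoid F) (tensor_relations (centre_ring R) K (to_residue_field R \<pp>) A g)"
abbreviation "T \<equiv> fibre_tensor R \<pp>"

sublocale h: ring_hom_ring "centre_ring R" D h
  by (rule p.rcos_ring_hom_ring)

lemma carrier_D: "carrier D = h ` centre R"
  unfolding FactRing_def A_RCOSETS_def' partial_object.simps centre_ring_simps by blast

lemma h_eq_iff:
  assumes "z \<in> centre R" "w \<in> centre R"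
  shows "h z = h w \<longleftrightarrow> z \<ominus> w \<in> \<pp>"
  using Z.quotient_eq_iff_same_a_r_cos[OF p.ideal_axioms, of z w] assms
  by (simp add: a_minus_def centre_ring_a_inv)

lemma h_eq_zero_iff: "z \<in> centre R \<Longrightarrow> h z = \<zero>\<^bsub>D\<^esub> \<longleftrightarrow> z \<in> \<pp>"
  using h_eq_iff[of z \<zero>] h.hom_zero Z.zero_closed centre_carrier[of z] by (simp add: a_minus_def)

lemma E_eq: "E = h ` C"
proof
  show "E \<subseteq> h ` C"
    unfolding carrier_D using h_eq_zero_iff by blast
  show "h ` C \<subseteq> E"
    unfolding carrier_D using h_eq_zero_iff by blast
qed

lemma h_in_E: "c \<in> C \<Longrightarrow> h c \<in> E"
  unfolding E_eq by blast

lemma h_closed: "z \<in> centre R \<Longrightarrow> h z \<in> carrier D"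
  unfolding carrier_D by blast

lemma g_closed: "r \<in> carrier R \<Longrightarrow> g r \<in> carrier A"
  unfolding carrier_A by blast

lemma g_in_S: "c \<in> C \<Longrightarrow> g c \<in> S"
  unfolding fibre_denoms_def by blast

lemma h_mult: "\<lbrakk>z \<in> centre R; w \<in> centre R\<rbrakk> \<Longrightarrow> h z \<otimes>\<^bsub>D\<^esub> h w = h (z \<otimes> w)"
  using h.hom_mult[of z w] by simp

lemma h_add: "\<lbrakk>z \<in> centre R; w \<in> centre R\<rbrakk> \<Longrightarrow> h z \<oplus>\<^bsub>D\<^esub> h w = h (z \<oplus> w)"
  using h.hom_add[of z w] by simp

lemma h_one: "\<one>\<^bsub>D\<^esub> = h \<one>"
  using h.hom_one by simp

lemma g_mult: "\<lbrakk>z \<in> carrier R; w \<in> carrier R\<rbrakk> \<Longrightarrow> g z \<otimes>\<^bsub>A\<^esub> g w = g (z \<otimes> w)"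
  using g.hom_mult[of z w] by simp

lemma g_add: "\<lbrakk>z \<in> carrier R; w \<in> carrier R\<rbrakk> \<Longrightarrow> g z \<oplus>\<^bsub>A\<^esub> g w = g (z \<oplus> w)"
  using g.hom_add[of z w] by simp

lemma g_one: "\<one>\<^bsub>A\<^esub> = g \<one>"
  using g.hom_one by simp

lemma centre_closed:
  "\<lbrakk>z \<in> centre R; w \<in> centre R\<rbrakk> \<Longrightarrow> z \<otimes> w \<in> centre R"
  "\<lbrakk>z \<in> centre R; w \<in> centre R\<rbrakk> \<Longrightarrow> z \<oplus> w \<in> centre R"
  "\<one> \<in> centre R"
  using Z.m_closed[of z w] Z.a_closed[of z w] Z.one_closed by simp_all

sublocale D: central_denominators D E
proof (intro central_denominators.intro central_denominators_axioms.intro)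
  show "ring D" by (rule p.quotient_is_ring)
  show "E \<subseteq> centre D"
    unfolding centre_def using cring.cring_simprules(14)[OF p.quotient_is_cring[OF Z.cring_axioms]]
    by blast
  show "\<one>\<^bsub>D\<^esub> \<in> E" using one_in_C h_in_E unfolding h_one by blast
  fix s t assume "s \<in> E" "t \<in> E"
  then obtain c d where cd: "c \<in> C" "d \<in> C" "s = h c" "t = h d" unfolding E_eq by blast
  then show "s \<otimes>\<^bsub>D\<^esub> t \<in> E"
    using h_mult[of c d] h_in_E[OF C_mult[of c d]] by (metis DiffD1)
qed

text \<open>Elements of k(\<pp>) are written with numerator in Z(R) and denominator in
  \<open>C\<close>, so that computing with them becomes computing in Z(R) modulo \<pp>.\<close>

definition frac :: "'a \<Rightarrow> 'a \<Rightarrow> ('a set \<times> 'a set) set" where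
  "frac z s = loc_frac D E (h z) (h s)"

lemma K_eq: "K = localization D E"
  by (simp add: residue_field_def Let_def)

lemma frac_closed: "\<lbrakk>z \<in> centre R; s \<in> C\<rbrakk> \<Longrightarrow> frac z s \<in> carrier K"
  unfolding K_eq frac_def by (intro D.loc_frac_closed h_closed h_in_E)

lemma frac_cases:
  assumes "k \<in> carrier K"
  obtains z s where "z \<in> centre R" "s \<in> C" "k = frac z s"
proof -
  obtain a b where "a \<in> carrier D" "b \<in> E" "k = loc_frac D E a b"
    using assms unfolding K_eq by (rule D.localization_cases)
  moreover obtain z where "z \<in> centre R" "a = h z"
    using \<open>a \<in> carrier D\<close> unfolding carrier_D by blast
  moreover obtain s where "s \<in> C" "b = h s"
    using \<open>b \<in> E\<close> unfolding E_eq by blast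
  ultimately show thesis
    using that[of z s] by (simp only: frac_def)
qed

lemma frac_eqD:
  assumes "z \<in> centre R" "s \<in> C" "w \<in> centre R" "t \<in> C" "frac z s = frac w t"
  shows "\<exists>u\<in>C. u \<otimes> (t \<otimes> z) \<ominus> u \<otimes> (s \<otimes> w) \<in> \<pp>"
proof -
  have "\<exists>u\<in>E. u \<otimes>\<^bsub>D\<^esub> (h t \<otimes>\<^bsub>D\<^esub> h z) = u \<otimes>\<^bsub>D\<^esub> (h s \<otimes>\<^bsub>D\<^esub> h w)"
    using D.loc_frac_eq_iff[OF h_closed[OF assms(1)] h_in_E[OF assms(2)]
        h_closed[OF assms(3)] h_in_E[OF assms(4)]] assms(5)
    unfolding frac_def by blast
  then obtain u where u: "u \<in> C" "h u \<otimes>\<^bsub>D\<^esub> (h t \<otimes>\<^bsub>D\<^esub> h z) = h u \<otimes>\<^bsub>D\<^esub> (h s \<otimes>\<^bsub>D\<^esub> h w)"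
    unfolding E_eq by blast
  have mem: "u \<in> centre R" "s \<in> centre R" "t \<in> centre R" "z \<in> centre R" "w \<in> centre R"
    using u(1) assms by blast+
  have "h (u \<otimes> (t \<otimes> z)) = h (u \<otimes> (s \<otimes> w))"
    using u(2) unfolding h_mult[OF mem(3,4)] h_mult[OF mem(2,5)]
      h_mult[OF mem(1) centre_closed(1)[OF mem(3,4)]]
      h_mult[OF mem(1) centre_closed(1)[OF mem(2,5)]] .
  then show ?thesis
    using u(1) h_eq_iff[of "u \<otimes> (t \<otimes> z)" "u \<otimes> (s \<otimes> w)"] mem centre_closed(1) by blast
qed

lemma frac_eqI:
  assumes "z \<in> centre R" "s \<in> C" "w \<in> centre R" "t \<in> C" "t \<otimes> z = s \<otimes> w"
  shows "frac z s = frac w t"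
  unfolding frac_def
proof (rule D.loc_frac_eqI)
  show "h t \<otimes>\<^bsub>D\<^esub> h z = h s \<otimes>\<^bsub>D\<^esub> h w"
    using h_mult[of t z] h_mult[of s w] assms by (metis DiffD1)
qed (use assms h_closed h_in_E in blast)+

lemma frac_mult:
  assumes "z \<in> centre R" "s \<in> C" "w \<in> centre R" "t \<in> C"
  shows "frac z s \<otimes>\<^bsub>K\<^esub> frac w t = frac (z \<otimes> w) (s \<otimes> t)"
proof -
  have "s \<in> centre R" "t \<in> centre R" using assms by blast+
  then show ?thesis
    unfolding frac_def K_eq
    using assms D.loc_frac_mult[of "h z" "h s" "h w" "h t"] h_mult[of z w] h_mult[of s t]
      h_closed h_in_E by metis
qed

lemma frac_add:
  assumes "z \<in> centre R" "s \<in> C" "w \<in> centre R" "t \<in> C"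
  shows "frac z s \<oplus>\<^bsub>K\<^esub> frac w t = frac (t \<otimes> z \<oplus> s \<otimes> w) (s \<otimes> t)"
proof -
  have "s \<in> centre R" "t \<in> centre R" using assms by blast+
  then show ?thesis
    unfolding frac_def K_eq
    using assms D.loc_frac_add[of "h z" "h s" "h w" "h t"] h_mult[of t z] h_mult[of s w]
      h_mult[of s t] h_add[of "t \<otimes> z" "s \<otimes> w"] centre_closed h_closed h_in_E by metis
qed

lemma K_one: "\<one>\<^bsub>K\<^esub> = frac \<one> \<one>"
  unfolding K_eq D.localization_one frac_def h_one ..

lemma to_residue_field_eq: "to_residue_field R \<pp> z = frac z \<one>"
  unfolding to_residue_field_def Let_def frac_def h_one ..

text \<open>The isomorphism from the tensor product to the localization sends \<open>(z/s) \<otimes> a\<close> to \<open>za/s\<close>.\<close>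

definition frac_times :: "('a set \<times> 'a set) set \<Rightarrow> 'a set \<Rightarrow> ('a set \<times> 'a set) set" where
  "frac_times k a = (SOME y. \<exists>z s. z \<in> centre R \<and> s \<in> C \<and> k = frac z s \<and>
     y = loc_frac A S (g z \<otimes>\<^bsub>A\<^esub> a) (g s))"

text \<open>The choice in \<open>frac_times\<close> is harmless: z/s = w/t yields u in
  \<open>C\<close> with u(tz - sw) in \<pp>, hence in \<open>J\<close>, and multiplication by a on
  the right shows za/s = wa/t with witness \<open>g u\<close>.\<close>

lemma frac_times_eq:
  assumes mem: "z \<in> centre R" "s \<in> C" and a: "a \<in> carrier A"
  shows "frac_times (frac z s) a = loc_frac A S (g z \<otimes>\<^bsub>A\<^esub> a) (g s)"
proof -
  have uniq: "y = loc_frac A S (g z \<otimes>\<^bsub>A\<^esub> a) (g s)"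
    if y: "\<exists>w t. w \<in> centre R \<and> t \<in> C \<and> frac z s = frac w t \<and>
      y = loc_frac A S (g w \<otimes>\<^bsub>A\<^esub> a) (g t)" for y
  proof -
    obtain w t where wt: "w \<in> centre R" "t \<in> C" "frac z s = frac w t"
      "y = loc_frac A S (g w \<otimes>\<^bsub>A\<^esub> a) (g t)" using y by blast
    obtain u where u: "u \<in> C" "u \<otimes> (t \<otimes> z) \<ominus> u \<otimes> (s \<otimes> w) \<in> \<pp>"
      using frac_eqD[OF mem wt(1,2,3)] by blast
    have c: "u \<in> carrier R" "t \<in> carrier R" "z \<in> carrier R" "s \<in> carrier R" "w \<in> carrier R"
      using u wt mem C_carrier centre_carrier by blast+
    have "g (u \<otimes> (t \<otimes> z)) = g (u \<otimes> (s \<otimes> w))"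
      using g_eq_iff[of "u \<otimes> (t \<otimes> z)" "u \<otimes> (s \<otimes> w)"] u c extended_inter_centre by blast
    then have "g u \<otimes>\<^bsub>A\<^esub> (g t \<otimes>\<^bsub>A\<^esub> g z) = g u \<otimes>\<^bsub>A\<^esub> (g s \<otimes>\<^bsub>A\<^esub> g w)"
      using c by simp
    then have "(g u \<otimes>\<^bsub>A\<^esub> (g t \<otimes>\<^bsub>A\<^esub> g z)) \<otimes>\<^bsub>A\<^esub> a = (g u \<otimes>\<^bsub>A\<^esub> (g s \<otimes>\<^bsub>A\<^esub> g w)) \<otimes>\<^bsub>A\<^esub> a"
      by (rule arg_cong)
    then have "g u \<otimes>\<^bsub>A\<^esub> (g t \<otimes>\<^bsub>A\<^esub> (g z \<otimes>\<^bsub>A\<^esub> a)) = g u \<otimes>\<^bsub>A\<^esub> (g s \<otimes>\<^bsub>A\<^esub> (g w \<otimes>\<^bsub>A\<^esub> a))"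
      using c a by (simp add: g.S.m_assoc)
    then show ?thesis
      unfolding wt(4) using mem wt c a g_closed g_in_S u(1)
      by (intro sym[OF A.loc_frac_eq_iff[THEN iffD2]] g.S.m_closed) blast+
  qed
  show ?thesis
    unfolding frac_times_def
  proof (rule someI2[where a = "loc_frac A S (g z \<otimes>\<^bsub>A\<^esub> a) (g s)"])
    show "\<exists>w t. w \<in> centre R \<and> t \<in> C \<and> frac z s = frac w t \<and>
        loc_frac A S (g z \<otimes>\<^bsub>A\<^esub> a) (g s) = loc_frac A S (g w \<otimes>\<^bsub>A\<^esub> a) (g t)"
      by (intro exI conjI) (rule mem refl)+
  qed (rule uniq)
qed

lemma frac_times_closed:
  assumes "k \<in> carrier K" "a \<in> carrier A"
  shows "frac_times k a \<in> carrier (localization A S)"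
proof -
  obtain z s where zs: "z \<in> centre R" "s \<in> C" "k = frac z s" using assms(1) by (rule frac_cases)
  then show ?thesis
    unfolding zs(3) frac_times_eq[OF zs(1,2) assms(2)]
    using assms(2) g_closed g_in_S centre_carrier by (intro A.loc_frac_closed g.S.m_closed) blast+
qed

text \<open>This lemma and the next two treat the three families of tensor relations. Together they
  make the additive extension of \<open>frac_times\<close> vanish on every relation.\<close>

lemma frac_times_add_left:
  assumes "k \<in> carrier K" "k' \<in> carrier K" "a \<in> carrier A"
  shows "frac_times (k \<oplus>\<^bsub>K\<^esub> k') a =
    frac_times k a \<oplus>\<^bsub>localization A S\<^esub> frac_times k' a"
proof -
  obtain z s where zs: "z \<in> centre R" "s \<in> C" "k = frac z s" using assms(1) by (rule frac_cases)
  obtain w t where wt: "w \<in> centre R" "t \<in> C" "k' = frac w t" using assms(2) by (rule frac_cases)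
  have st: "s \<in> centre R" "t \<in> centre R" using zs wt by blast+
  have mem: "t \<otimes> z \<oplus> s \<otimes> w \<in> centre R"
    using zs(1) wt(1) st by (intro centre_closed)
  have c: "z \<in> carrier R" "s \<in> carrier R" "w \<in> carrier R" "t \<in> carrier R"
    using zs wt C_carrier centre_carrier by blast+
  have S: "g s \<in> S" "g t \<in> S" using zs wt g_in_S by blast+
  have "frac_times (k \<oplus>\<^bsub>K\<^esub> k') a = loc_frac A S (g (t \<otimes> z \<oplus> s \<otimes> w) \<otimes>\<^bsub>A\<^esub> a) (g (s \<otimes> t))"
    unfolding zs(3) wt(3) frac_add[OF zs(1,2) wt(1,2)]
    by (rule frac_times_eq[OF mem C_mult[OF zs(2) wt(2)] assms(3)])
  also have "g (t \<otimes> z \<oplus> s \<otimes> w) \<otimes>\<^bsub>A\<^esub> a =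
      g t \<otimes>\<^bsub>A\<^esub> (g z \<otimes>\<^bsub>A\<^esub> a) \<oplus>\<^bsub>A\<^esub> g s \<otimes>\<^bsub>A\<^esub> (g w \<otimes>\<^bsub>A\<^esub> a)"
    using c assms(3) by (simp add: g.S.l_distr g.S.m_assoc)
  also have "g (s \<otimes> t) = g s \<otimes>\<^bsub>A\<^esub> g t" using c by simp
  finally show ?thesis
    unfolding zs(3) wt(3) frac_times_eq[OF zs(1,2) assms(3)] frac_times_eq[OF wt(1,2) assms(3)]
    using c S assms(3) by (subst A.loc_frac_add) simp_all
qed

lemma frac_times_add_right:
  assumes "k \<in> carrier K" "a \<in> carrier A" "b \<in> carrier A"
  shows "frac_times k (a \<oplus>\<^bsub>A\<^esub> b) =
    frac_times k a \<oplus>\<^bsub>localization A S\<^esub> frac_times k b"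
proof -
  obtain z s where zs: "z \<in> centre R" "s \<in> C" "k = frac z s" using assms(1) by (rule frac_cases)
  have c: "z \<in> carrier R" "g s \<in> S" using zs centre_carrier g_in_S by blast+
  show ?thesis
    unfolding zs(3) frac_times_eq[OF zs(1,2) assms(2)] frac_times_eq[OF zs(1,2) assms(3)]
      frac_times_eq[OF zs(1,2) g.S.a_closed[OF assms(2,3)]]
    using c assms by (subst A.loc_frac_add_same) (simp_all add: g.S.r_distr)
qed

lemma frac_times_balanced:
  assumes "w \<in> centre R" "k \<in> carrier K" "a \<in> carrier A"
  shows "frac_times (to_residue_field R \<pp> w \<otimes>\<^bsub>K\<^esub> k) a = frac_times k (g w \<otimes>\<^bsub>A\<^esub> a)"
proof -
  obtain z s where zs: "z \<in> centre R" "s \<in> C" "k = frac z s" using assms(2) by (rule frac_cases)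
  have c: "z \<in> carrier R" "w \<in> carrier R" "s \<in> carrier R"
    using zs assms centre_carrier C_carrier by blast+
  have "to_residue_field R \<pp> w \<otimes>\<^bsub>K\<^esub> k = frac (z \<otimes> w) s"
    unfolding zs(3) to_residue_field_eq frac_mult[OF assms(1) one_in_C zs(1,2)]
    using c by (simp add: centre_comm[OF assms(1)])
  then show ?thesis
    unfolding zs(3) using frac_times_eq[OF centre_closed(1)[OF zs(1) assms(1)] zs(2) assms(3)]
      frac_times_eq[OF zs(1,2) g.S.m_closed[OF g_closed[OF c(2)] assms(3)]] c assms(3)
    by (simp add: g.S.m_assoc)
qed

section \<open>The free abelian group on pairs and its subgroup of relations\<close>

lemma add_monoid_F: "add_monoid F = free_Abelian_group (carrier K \<times> carrier A)"
  by (simp add: free_pair_ring_def free_Abelian_group_def)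

lemma abelian_group_F: "abelian_group F"
proof -
  interpret G: comm_group "free_Abelian_group (carrier K \<times> carrier A)"
    by (rule abelian_free_Abelian_group)
  show ?thesis
    unfolding abelian_group_def abelian_group_axioms_def abelian_monoid_def add_monoid_F
    using G.comm_monoid_axioms G.comm_group_axioms by blast
qed

sublocale F: abelian_group F by (rule abelian_group_F)

lemma F_simps [simp]:
  "x \<in> carrier F \<longleftrightarrow> Poly_Mapping.keys x \<subseteq> carrier K \<times> carrier A"
  "x \<oplus>\<^bsub>F\<^esub> y = x + y" "\<zero>\<^bsub>F\<^esub> = 0" "\<one>\<^bsub>F\<^esub> = frag_of (\<one>\<^bsub>K\<^esub>, \<one>\<^bsub>A\<^esub>)"
  by (simp_all add: free_pair_ring_def)

lemma frag_of_mult: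
  "frag_of (k, a) \<otimes>\<^bsub>F\<^esub> frag_of (l, b) = frag_of (k \<otimes>\<^bsub>K\<^esub> l, a \<otimes>\<^bsub>A\<^esub> b)"
  by (simp add: free_pair_ring_def)

lemma K_closed:
  assumes "k \<in> carrier K" "l \<in> carrier K"
  shows "k \<oplus>\<^bsub>K\<^esub> l \<in> carrier K" "k \<otimes>\<^bsub>K\<^esub> l \<in> carrier K"
proof -
  obtain z s where zs: "z \<in> centre R" "s \<in> C" "k = frac z s" using assms(1) by (rule frac_cases)
  obtain w t where wt: "w \<in> centre R" "t \<in> C" "l = frac w t" using assms(2) by (rule frac_cases)
  have st: "s \<in> centre R" "t \<in> centre R" using zs wt by blast+
  show "k \<oplus>\<^bsub>K\<^esub> l \<in> carrier K"
    unfolding zs(3) wt(3) frac_add[OF zs(1,2) wt(1,2)]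
    by (intro frac_closed centre_closed C_mult zs wt st)
  show "k \<otimes>\<^bsub>K\<^esub> l \<in> carrier K"
    unfolding zs(3) wt(3) frac_mult[OF zs(1,2) wt(1,2)]
    by (intro frac_closed centre_closed C_mult zs wt st)
qed

lemma relation_cases:
  assumes "x \<in> tensor_relations (centre_ring R) K (to_residue_field R \<pp>) A g"
  obtains
    (add_left) k k' a where "k \<in> carrier K" "k' \<in> carrier K" "a \<in> carrier A"
      "x = frag_of (k \<oplus>\<^bsub>K\<^esub> k', a) - frag_of (k, a) - frag_of (k', a)"
  | (add_right) k a b where "k \<in> carrier K" "a \<in> carrier A" "b \<in> carrier A"
      "x = frag_of (k, a \<oplus>\<^bsub>A\<^esub> b) - frag_of (k, a) - frag_of (k, b)"
  | (balanced) w k a where "w \<in> centre R" "k \<in> carrier K" "a \<in> carrier A"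
      "x = frag_of (to_residue_field R \<pp> w \<otimes>\<^bsub>K\<^esub> k, a) - frag_of (k, g w \<otimes>\<^bsub>A\<^esub> a)"
  using assms unfolding tensor_relations_def centre_ring_simps by blast

lemma relations_subset:
  "tensor_relations (centre_ring R) K (to_residue_field R \<pp>) A g \<subseteq> carrier F"
proof
  fix x assume "x \<in> tensor_relations (centre_ring R) K (to_residue_field R \<pp>) A g"
  then show "x \<in> carrier F"
  proof (cases rule: relation_cases)
    case (add_left k k' a)
    then show ?thesis
      unfolding F_simps add_left(4) by (intro keys_diff3) (auto intro: K_closed)
  next
    case (add_right k a b)
    then show ?thesis
      unfolding F_simps add_right(4) by (intro keys_diff3) auto
  next
    case (balanced w k a)
    have "to_residue_field R \<pp> w \<in> carrier K"
      unfolding to_residue_field_eq by (rule frac_closed[OF balanced(1) one_in_C])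
    then show ?thesis
      using balanced(1-3) g_closed[OF centre_carrier[OF balanced(1)]]
      unfolding F_simps balanced(4) by (intro keys_diff3(2)) (auto intro: K_closed)
  qed
qed

sublocale N: abelian_subgroup N F
  using F.a_comm_group group.generate_is_subgroup[OF F.a_group]
    relations_subset by (intro abelian_subgroupI2) auto

text \<open>The universal property of the free abelian group extends \<open>frac_times\<close> to a
  homomorphism \<open>H\<close> into the localization of R/J. It kills the relations, hence
  \<open>N\<close>, and sends the pair (1/s, a) to a/s. If that pair is in \<open>N\<close>, then
  a/s is zero, so ua is in \<open>J\<close> for some u in \<open>C\<close>, and regularity gives the
  claim.\<close>

lemma fraction_zeroD:
  assumes s: "s \<in> C" and a: "a \<in> carrier R" and N: "frag_of (frac \<one> s, g a) \<in> N"
  shows "a \<in> J"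
proof -
  let ?L = "localization A S" and ?G = "free_Abelian_group (carrier K \<times> carrier A)"
  interpret L: abelian_group ?L by (rule A.abelian_group_localization)
  have im: "case_prod frac_times ` (carrier K \<times> carrier A) \<subseteq> carrier (add_monoid ?L)"
    using frac_times_closed by (simp add: image_subset_iff split_beta)
  obtain H where H: "H \<in> hom ?G (add_monoid ?L)"
    and Hf: "\<And>x. x \<in> carrier K \<times> carrier A \<Longrightarrow> H (frag_of x) = case_prod frac_times x"
    using comm_group.free_Abelian_group_universal[OF L.a_comm_group im] by metis
  interpret H: group_hom ?G "add_monoid ?L" H
    using H L.a_group by (simp add: group_hom_def group_hom_axioms_def)
  have Hadd: "H (x + y) = H x \<oplus>\<^bsub>?L\<^esub> H y"
    if "Poly_Mapping.keys x \<subseteq> carrier K \<times> carrier A" "Poly_Mapping.keys y \<subseteq> carrier K \<times> carrier A" for x y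
    using H.hom_mult[of x y] that by simp
  have Hc: "H x \<in> carrier ?L" if "Poly_Mapping.keys x \<subseteq> carrier K \<times> carrier A" for x
    using H.hom_closed[of x] that by simp
  \<comment> \<open>A relation x is a difference, while additivity of \<open>H\<close> is stated for
    sums. So y is taken to be the part subtracted in x, and vanishing is read off from the values at
    x + y and y.\<close>
  have H0: "H x = \<zero>\<^bsub>?L\<^esub>"
    if "Poly_Mapping.keys x \<subseteq> carrier K \<times> carrier A" "Poly_Mapping.keys y \<subseteq> carrier K \<times> carrier A" "H (x + y) = H y" for x y
    using Hadd[of x y] that Hc[of x] Hc[of y] L.add.r_cancel_one by simp
  have "tensor_relations (centre_ring R) K (to_residue_field R \<pp>) A g \<subseteq> kernel ?G (add_monoid ?L) H"
  proof
    fix x assume x: "x \<in> tensor_relations (centre_ring R) K (to_residue_field R \<pp>) A g"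
    then have xF: "Poly_Mapping.keys x \<subseteq> carrier K \<times> carrier A"
      using relations_subset F_simps(1) by blast
    from x have "H x = \<zero>\<^bsub>?L\<^esub>"
    proof (cases rule: relation_cases)
      case (add_left k k' a)
      have m: "k \<oplus>\<^bsub>K\<^esub> k' \<in> carrier K" by (rule K_closed(1)[OF add_left(1,2)])
      have "H (frag_of (k, a) + frag_of (k', a)) = H (x + (frag_of (k, a) + frag_of (k', a)))"
        unfolding add_left(4)
        using add_left(1-3) m by (subst Hadd) (auto simp: Hf frac_times_add_left keys_frag_of)
      then show ?thesis
        using xF add_left(1-3) keys_add[of "frag_of (k, a)" "frag_of (k', a)"]
        by (intro H0[of x "frag_of (k, a) + frag_of (k', a)"]) (auto simp: keys_frag_of)
    next
      case (add_right k a b)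
      have "H (frag_of (k, a) + frag_of (k, b)) = H (x + (frag_of (k, a) + frag_of (k, b)))"
        unfolding add_right(4)
        using add_right(1-3) by (subst Hadd) (auto simp: Hf frac_times_add_right keys_frag_of)
      then show ?thesis
        using xF add_right(1-3) keys_add[of "frag_of (k, a)" "frag_of (k, b)"]
        by (intro H0[of x "frag_of (k, a) + frag_of (k, b)"]) (auto simp: keys_frag_of)
    next
      case (balanced w k a)
      have w: "g w \<in> carrier A" by (rule g_closed[OF centre_carrier[OF balanced(1)]])
      have "to_residue_field R \<pp> w \<in> carrier K"
        unfolding to_residue_field_eq by (rule frac_closed[OF balanced(1) one_in_C])
      then have m: "to_residue_field R \<pp> w \<otimes>\<^bsub>K\<^esub> k \<in> carrier K"
        using K_closed(2) balanced(2) by blast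
      have "H (frag_of (k, g w \<otimes>\<^bsub>A\<^esub> a)) = H (x + frag_of (k, g w \<otimes>\<^bsub>A\<^esub> a))"
        unfolding balanced(4)
        using balanced(1-3) m w Hf frac_times_balanced by simp
      then show ?thesis
        using xF balanced(1-3) w
        by (intro H0[of x "frag_of (k, g w \<otimes>\<^bsub>A\<^esub> a)"]) (auto simp: keys_frag_of)
    qed
    then show "x \<in> kernel ?G (add_monoid ?L) H"
      using xF by (simp add: kernel_def)
  qed
  then have "N \<subseteq> kernel ?G (add_monoid ?L) H"
    unfolding add_monoid_F
    using group.generate_subgroup_incl[OF group_free_Abelian_group _ H.subgroup_kernel] by blast
  then have "H (frag_of (frac \<one> s, g a)) = \<zero>\<^bsub>?L\<^esub>"
    using N unfolding kernel_def by auto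
  moreover have "H (frag_of (frac \<one> s, g a)) = loc_frac A S (g \<one> \<otimes>\<^bsub>A\<^esub> g a) (g s)"
    using Hf[of "(frac \<one> s, g a)"] frac_closed[OF centre_closed(3) s] g_closed[OF a]
      frac_times_eq[OF centre_closed(3) s g_closed[OF a]] by simp
  ultimately have "loc_frac A S (g \<one> \<otimes>\<^bsub>A\<^esub> g a) (g s) = loc_frac A S \<zero>\<^bsub>A\<^esub> \<one>\<^bsub>A\<^esub>"
    by (simp add: A.localization_zero)
  then have "\<exists>u\<in>S. u \<otimes>\<^bsub>A\<^esub> (\<one>\<^bsub>A\<^esub> \<otimes>\<^bsub>A\<^esub> (g \<one> \<otimes>\<^bsub>A\<^esub> g a)) = u \<otimes>\<^bsub>A\<^esub> (g s \<otimes>\<^bsub>A\<^esub> \<zero>\<^bsub>A\<^esub>)"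
    using a g_in_S[OF s] A.denoms_one by (subst (asm) A.loc_frac_eq_iff) simp_all
  then obtain u where u: "u \<in> C"
    "g u \<otimes>\<^bsub>A\<^esub> (\<one>\<^bsub>A\<^esub> \<otimes>\<^bsub>A\<^esub> (g \<one> \<otimes>\<^bsub>A\<^esub> g a)) = g u \<otimes>\<^bsub>A\<^esub> (g s \<otimes>\<^bsub>A\<^esub> \<zero>\<^bsub>A\<^esub>)"
    unfolding fibre_denoms_def by blast
  have "g (u \<otimes> a) = \<zero>\<^bsub>A\<^esub>"
    using u(2) a C_carrier[OF u(1)] C_carrier[OF s] by simp
  then have "u \<otimes> a \<in> J"
    using g_eq_zero_iff[of "u \<otimes> a"] a C_carrier[OF u(1)] by blast
  then show ?thesis using C_regular u(1) a by blast
qed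

end

section \<open>The tensor product as a ring of fractions of R/J\<close>

lemma FactRing_sel:
  "carrier (Q Quot I) = a_rcosets\<^bsub>Q\<^esub> I"
  "X \<oplus>\<^bsub>Q Quot I\<^esub> Y = X <+>\<^bsub>Q\<^esub> Y"
  "X \<otimes>\<^bsub>Q Quot I\<^esub> Y = rcoset_mult Q I X Y"
  "\<zero>\<^bsub>Q Quot I\<^esub> = I"
  "\<one>\<^bsub>Q Quot I\<^esub> = I +>\<^bsub>Q\<^esub> \<one>\<^bsub>Q\<^esub>"
  by (simp_all add: FactRing_def)

locale simple_artinian_fibre = torsion_free_fibre +
  assumes simple_T: "simple_ring (fibre_tensor R \<pp>)"
    and artinian_T: "artinian_ring (fibre_tensor R \<pp>)"
begin

lemma T_eq: "T = F Quot N"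
  by (simp add: fibre_tensor_def tensor_ring_def)

text \<open>Being a ring is part of \<open>simple_ring\<close>, so the ring axioms of the tensor
  product come from the hypothesis on \<pp>.\<close>

sublocale T: ring T
  using simple_T by (simp add: simple_ring_def)

definition cls where "cls x = N +>\<^bsub>F\<^esub> x"

lemma carrier_T: "carrier T = cls ` carrier F"
  unfolding T_eq FactRing_sel A_RCOSETS_def' cls_def by blast

lemma cls_closed: "x \<in> carrier F \<Longrightarrow> cls x \<in> carrier T"
  unfolding carrier_T by (rule imageI)

lemma cls_add:
  assumes "x \<in> carrier F" "y \<in> carrier F"
  shows "cls x \<oplus>\<^bsub>T\<^esub> cls y = cls (x + y)"
  using N.a_rcos_sum[OF assms] unfolding T_eq FactRing_sel cls_def F_simps(2) .

lemma cls_zero: "\<zero>\<^bsub>T\<^esub> = cls 0"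
  using F.a_coset_add_zero[OF N.a_subset] unfolding T_eq FactRing_sel cls_def F_simps(3) by (rule sym)

lemma cls_eq_zero_iff: "x \<in> carrier F \<Longrightarrow> cls x = \<zero>\<^bsub>T\<^esub> \<longleftrightarrow> x \<in> N"
proof
  assume "x \<in> carrier F" "cls x = \<zero>\<^bsub>T\<^esub>"
  then show "x \<in> N"
    using N.a_rcos_self[of x] unfolding T_eq FactRing_sel cls_def by blast
next
  assume "x \<in> N"
  then show "cls x = \<zero>\<^bsub>T\<^esub>"
    using N.a_rcos_const[of x] unfolding T_eq FactRing_sel cls_def by blast
qed

text \<open>As the quotient is known to be a ring, a product of two cosets is a coset, so it is determined
  by the product of any two representatives.\<close>

lemma cls_mult:
  assumes x: "x \<in> carrier F" and y: "y \<in> carrier F" and xy: "x \<otimes>\<^bsub>F\<^esub> y \<in> carrier F"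
  shows "cls x \<otimes>\<^bsub>T\<^esub> cls y = cls (x \<otimes>\<^bsub>F\<^esub> y)"
proof -
  obtain w where w: "w \<in> carrier F" "cls x \<otimes>\<^bsub>T\<^esub> cls y = cls w"
    using T.m_closed[OF cls_closed[OF x] cls_closed[OF y]] unfolding carrier_T by blast
  have "x \<in> cls x" "y \<in> cls y"
    unfolding cls_def by (rule N.a_rcos_self; fact)+
  have "x \<otimes>\<^bsub>F\<^esub> y \<in> cls (x \<otimes>\<^bsub>F\<^esub> y)"
    unfolding cls_def by (rule N.a_rcos_self[OF xy])
  moreover have "cls (x \<otimes>\<^bsub>F\<^esub> y) \<subseteq> cls x \<otimes>\<^bsub>T\<^esub> cls y"
    unfolding T_eq FactRing_sel rcoset_mult_def
    using \<open>x \<in> cls x\<close> \<open>y \<in> cls y\<close> unfolding cls_def[of "x \<otimes>\<^bsub>F\<^esub> y"] by blast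
  ultimately have "x \<otimes>\<^bsub>F\<^esub> y \<in> cls w" unfolding w(2) by blast
  then show ?thesis
    unfolding w(2) unfolding cls_def using N.a_repr_independence' w(1) by blast
qed

text \<open>The element (1/s) \<otimes> a of the tensor product, with a in R standing for its class
  modulo \<open>J\<close>.\<close>

definition fraction where "fraction s a = cls (frag_of (frac \<one> s, g a))"

lemma fraction_rep: "\<lbrakk>s \<in> C; a \<in> carrier R\<rbrakk> \<Longrightarrow> frag_of (frac \<one> s, g a) \<in> carrier F"
  using frac_closed[OF centre_closed(3), of s] g_closed[of a]
  unfolding F_simps by (simp add: keys_frag_of)

lemma fraction_closed: "\<lbrakk>s \<in> C; a \<in> carrier R\<rbrakk> \<Longrightarrow> fraction s a \<in> carrier T"
  unfolding fraction_def by (intro cls_closed fraction_rep)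

lemma relation_in_N: "x \<in> tensor_relations (centre_ring R) K (to_residue_field R \<pp>) A g \<Longrightarrow> x \<in> N"
  by (rule generate.incl)

lemma cls_eqI:
  assumes "x \<in> carrier F" "y \<in> carrier F" "x - y \<in> N"
  shows "cls x = cls y"
proof -
  have "x - y \<in> carrier F" using N.a_subset assms(3) by blast
  then have "cls (x - y) \<oplus>\<^bsub>T\<^esub> cls y = cls x"
    using cls_add[of "x - y" y] assms by simp
  then show ?thesis
    using cls_eq_zero_iff[OF \<open>x - y \<in> carrier F\<close>] assms cls_closed[of y] T.l_zero by simp
qed

text \<open>z/s is z times 1/s, and the balancing relation carries the factor z over to the second
  component.\<close>

lemma cls_frag_of:
  assumes "z \<in> centre R" "s \<in> C" "a \<in> carrier R"
  shows "cls (frag_of (frac z s, g a)) = fraction s (z \<otimes> a)"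
proof -
  have z: "z \<in> carrier R" using assms centre_carrier by blast
  have s: "s \<in> carrier R" using assms C_carrier by blast
  have "to_residue_field R \<pp> z \<otimes>\<^bsub>K\<^esub> frac \<one> s = frac z s"
    unfolding to_residue_field_eq frac_mult[OF assms(1) one_in_C centre_closed(3) assms(2)]
    using z s by simp
  then have "frag_of (frac z s, g a) - frag_of (frac \<one> s, g z \<otimes>\<^bsub>A\<^esub> g a) \<in>
      tensor_relations (centre_ring R) K (to_residue_field R \<pp>) A g"
    unfolding tensor_relations_def centre_ring_simps
    using assms(1) frac_closed[OF centre_closed(3) assms(2)] g_closed[OF assms(3)]
    by (intro UnI2 CollectI exI[of _ z] exI[of _ "frac \<one> s"] exI[of _ "g a"]) simp
  then have "frag_of (frac z s, g a) - frag_of (frac \<one> s, g (z \<otimes> a)) \<in> N"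
    using relation_in_N g_mult[OF z assms(3)] by simp
  moreover have "frag_of (frac z s, g a) \<in> carrier F"
    using frac_closed[OF assms(1,2)] g_closed[OF assms(3)] by (simp add: keys_frag_of)
  ultimately show ?thesis
    unfolding fraction_def using fraction_rep[OF assms(2), of "z \<otimes> a"] z assms(3)
    by (intro cls_eqI) simp_all
qed

text \<open>Write 1/s as t/(st) and carry t across the tensor sign. This is the passage to a common
  denominator.\<close>

lemma fraction_expand:
  assumes "s \<in> C" "t \<in> C" "a \<in> carrier R"
  shows "fraction s a = fraction (s \<otimes> t) (t \<otimes> a)"
proof -
  have c: "s \<in> carrier R" "t \<in> carrier R" "t \<in> centre R" "s \<in> centre R" using assms C_carrier by blast+
  have "frac \<one> s = frac t (s \<otimes> t)"
    using assms c C_mult by (intro frac_eqI centre_closed(3)) simp_all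
  then show ?thesis
    using cls_frag_of[OF c(3) C_mult[OF assms(1,2)] assms(3)] by (simp add: fraction_def)
qed

lemma fraction_add:
  assumes "s \<in> C" "a \<in> carrier R" "b \<in> carrier R"
  shows "fraction s a \<oplus>\<^bsub>T\<^esub> fraction s b = fraction s (a \<oplus> b)"
proof -
  have k: "frac \<one> s \<in> carrier K" by (rule frac_closed[OF centre_closed(3) assms(1)])
  have "frag_of (frac \<one> s, g a \<oplus>\<^bsub>A\<^esub> g b) - frag_of (frac \<one> s, g a) - frag_of (frac \<one> s, g b) \<in>
      tensor_relations (centre_ring R) K (to_residue_field R \<pp>) A g"
    unfolding tensor_relations_def
    using k g_closed[OF assms(2)] g_closed[OF assms(3)] by blast
  then have "frag_of (frac \<one> s, g (a \<oplus> b)) - (frag_of (frac \<one> s, g a) + frag_of (frac \<one> s, g b)) \<in> N"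
    using relation_in_N g_add[OF assms(2,3)] by (simp add: diff_diff_eq)
  then show ?thesis
    unfolding fraction_def
    using fraction_rep[OF assms(1)] assms(2,3) F.a_closed[OF fraction_rep[OF assms(1,2)] fraction_rep[OF assms(1,3)]]
    by (subst cls_add; (intro sym[OF cls_eqI])?) (simp_all only: F_simps(2) a_closed)
qed

lemma fraction_mult:
  assumes "s \<in> C" "a \<in> carrier R" "t \<in> C" "b \<in> carrier R"
  shows "fraction s a \<otimes>\<^bsub>T\<^esub> fraction t b = fraction (s \<otimes> t) (a \<otimes> b)"
proof -
  have "frag_of (frac \<one> s, g a) \<otimes>\<^bsub>F\<^esub> frag_of (frac \<one> t, g b) = frag_of (frac \<one> (s \<otimes> t), g (a \<otimes> b))"
    unfolding frag_of_mult frac_mult[OF centre_closed(3) assms(1) centre_closed(3) assms(3)]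
      g_mult[OF assms(2,4)] by simp
  then show ?thesis
    unfolding fraction_def
    using cls_mult[OF fraction_rep[OF assms(1,2)] fraction_rep[OF assms(3,4)]]
      fraction_rep[OF C_mult[OF assms(1,3)] m_closed[OF assms(2,4)]] by simp
qed

lemma fraction_one: "\<one>\<^bsub>T\<^esub> = fraction \<one> \<one>"
  unfolding fraction_def T_eq FactRing_sel cls_def F_simps(4) K_one g_one ..

lemma fraction_zero: "s \<in> C \<Longrightarrow> fraction s \<zero> = \<zero>\<^bsub>T\<^esub>"
  using fraction_add[of s \<zero> \<zero>] fraction_closed[of s \<zero>] T.add.r_cancel_one[of "fraction s \<zero>"] by simp

lemma fraction_eq_zero_iff:
  assumes "s \<in> C" "a \<in> carrier R"
  shows "fraction s a = \<zero>\<^bsub>T\<^esub> \<longleftrightarrow> a \<in> J"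
proof
  assume "fraction s a = \<zero>\<^bsub>T\<^esub>"
  then show "a \<in> J"
    using fraction_zeroD[OF assms] cls_eq_zero_iff[OF fraction_rep[OF assms]]
    unfolding fraction_def by blast
next
  assume "a \<in> J"
  then have "g a = g \<zero>" using g_eq_zero_iff[OF assms(2)] g.hom_zero by metis
  then show "fraction s a = \<zero>\<^bsub>T\<^esub>"
    using fraction_zero[OF assms(1)] unfolding fraction_def by metis
qed

lemma fraction_eq_iff:
  assumes "s \<in> C" "a \<in> carrier R" "b \<in> carrier R"
  shows "fraction s a = fraction s b \<longleftrightarrow> a \<ominus> b \<in> J"
proof -
  have "fraction s (a \<ominus> b) \<oplus>\<^bsub>T\<^esub> fraction s b = fraction s a"
    using assms by (subst fraction_add) (auto simp: a_minus_def a_assoc l_neg)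
  then have "fraction s a = fraction s b \<longleftrightarrow> fraction s (a \<ominus> b) = \<zero>\<^bsub>T\<^esub>"
    using assms fraction_closed T.add.r_cancel_one[of "fraction s b" "fraction s (a \<ominus> b)"] by simp
  then show ?thesis using fraction_eq_zero_iff assms by simp
qed

text \<open>Induction over the free abelian group. A generator is a pair (z/s, a) and is covered by
  \<open>cls_frag_of\<close>; a difference of two fractions is brought to the common denominator
  st.\<close>

lemma fraction_cases:
  assumes "x \<in> carrier T"
  obtains s a where "s \<in> C" "a \<in> carrier R" "x = fraction s a"
proof -
  obtain y where y: "y \<in> carrier F" "x = cls y" using assms unfolding carrier_T by blast
  define P where "P y \<longleftrightarrow> (\<exists>s a. s \<in> C \<and> a \<in> carrier R \<and> cls y = fraction s a)" for y
  have "Poly_Mapping.keys y \<subseteq> carrier K \<times> carrier A" using y by simp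
  then have "P y"
  proof (rule free_Abelian_group_induct)
    show "P 0"
      unfolding P_def using one_in_C fraction_zero[OF one_in_C] cls_zero zero_closed by metis
  next
    fix x y
    assume keys: "Poly_Mapping.keys x \<subseteq> carrier K \<times> carrier A" "Poly_Mapping.keys y \<subseteq> carrier K \<times> carrier A"
      and "P x" "P y"
    then obtain s a t b where st: "s \<in> C" "t \<in> C" and ab: "a \<in> carrier R" "b \<in> carrier R"
      and x: "cls x = fraction s a" and y: "cls y = fraction t b" unfolding P_def by blast
    have c: "s \<in> carrier R" "t \<in> carrier R" "s \<in> centre R" using st C_carrier by blast+
    have x': "cls x = fraction (s \<otimes> t) (t \<otimes> a)"
      unfolding x by (rule fraction_expand[OF st ab(1)])
    have y': "cls y = fraction (s \<otimes> t) (s \<otimes> b)"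
      unfolding y fraction_expand[OF st(2,1) ab(2)] centre_comm[OF c(3,2)] ..
    have F: "x \<in> carrier F" "y \<in> carrier F" "x - y \<in> carrier F"
      using keys keys_diff[of x y] by auto
    \<comment> \<open>The class of the difference is found by solving this equation: the explicit
      fraction below satisfies it too, and addition in \<open>T\<close> is cancellative.\<close>
    have "cls (x - y) \<oplus>\<^bsub>T\<^esub> cls y = cls x" using cls_add[OF F(3,2)] by simp
    also have "\<dots> = fraction (s \<otimes> t) (t \<otimes> a \<ominus> s \<otimes> b) \<oplus>\<^bsub>T\<^esub> cls y"
      unfolding x' y' using ab c
      by (subst fraction_add[OF C_mult[OF st]]) (auto simp: a_minus_def a_assoc l_neg)
    finally have "cls (x - y) = fraction (s \<otimes> t) (t \<otimes> a \<ominus> s \<otimes> b)"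
      using cls_closed F fraction_closed[OF C_mult[OF st]] ab c by simp
    then show "P (x - y)"
      unfolding P_def using C_mult[OF st] ab c
      by (intro exI[of _ "s \<otimes> t"] exI[of _ "t \<otimes> a \<ominus> s \<otimes> b"]) simp
  next
    fix x assume "x \<in> carrier K \<times> carrier A"
    then obtain k a where x: "x = (k, a)" "k \<in> carrier K" "a \<in> carrier A" by blast
    obtain z s where zs: "z \<in> centre R" "s \<in> C" "k = frac z s" using x(2) by (rule frac_cases)
    obtain r where r: "r \<in> carrier R" "a = g r" using x(3) unfolding carrier_A by blast
    have "cls (frag_of x) = fraction s (z \<otimes> r)"
      unfolding x(1) zs(3) r(2) by (rule cls_frag_of[OF zs(1,2) r(1)])
    then show "P (frag_of x)"
      unfolding P_def using zs(2) m_closed[OF centre_carrier[OF zs(1)] r(1)] by blast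
  qed
  then show thesis using that y(2) unfolding P_def by blast
qed

end

section \<open>Extension of left ideals to the tensor product, and the minimum condition\<close>

lemma (in ring) left_idealI:
  assumes "L \<subseteq> carrier R" "\<zero> \<in> L"
    and "\<And>x y. \<lbrakk>x \<in> L; y \<in> L\<rbrakk> \<Longrightarrow> x \<oplus> y \<in> L"
    and l: "\<And>r x. \<lbrakk>r \<in> carrier R; x \<in> L\<rbrakk> \<Longrightarrow> r \<otimes> x \<in> L"
  shows "left_ideal L R"
proof -
  have "\<ominus> x \<in> L" if "x \<in> L" for x
    using l[of "\<ominus> \<one>" x] that assms(1) by (auto simp: l_minus)
  then have "subgroup L (add_monoid R)"
    using assms by (intro subgroup.intro) (auto simp flip: a_inv_def)
  then show ?thesis
    using l by (simp add: left_ideal_def additive_subgroup_def)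
qed

lemma left_idealD:
  assumes "left_ideal L R"
  shows "additive_subgroup L R" "\<And>r x. \<lbrakk>r \<in> carrier R; x \<in> L\<rbrakk> \<Longrightarrow> r \<otimes>\<^bsub>R\<^esub> x \<in> L"
  using assms by (auto simp: left_ideal_def)

context simple_artinian_fibre
begin

definition fractions where
  "fractions L = {fraction s a |s a. s \<in> C \<and> a \<in> L}"

lemma fractionsI: "\<lbrakk>s \<in> C; a \<in> L\<rbrakk> \<Longrightarrow> fraction s a \<in> fractions L"
  unfolding fractions_def by blast

lemma left_ideal_fractions:
  assumes "left_ideal L R"
  shows "left_ideal (fractions L) T"
proof (rule T.left_idealI)
  interpret L: additive_subgroup L R by (rule left_idealD[OF assms])
  have Lc: "a \<in> carrier R" if "a \<in> L" for a using that L.a_subset by blast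
  show "fractions L \<subseteq> carrier T"
    unfolding fractions_def using fraction_closed Lc by blast
  show "\<zero>\<^bsub>T\<^esub> \<in> fractions L"
    unfolding fractions_def using fraction_zero[OF one_in_C] one_in_C L.zero_closed by force
  show "x \<oplus>\<^bsub>T\<^esub> y \<in> fractions L" if xy: "x \<in> fractions L" "y \<in> fractions L" for x y
  proof -
    obtain s a t b where st: "s \<in> C" "t \<in> C" and ab: "a \<in> L" "b \<in> L"
      and x: "x = fraction s a" and y: "y = fraction t b"
      using xy unfolding fractions_def by blast
    have c: "s \<in> carrier R" "t \<in> carrier R" "s \<in> centre R" using st C_carrier by blast+
    have "y = fraction (s \<otimes> t) (s \<otimes> b)"
      unfolding y fraction_expand[OF st(2,1) Lc[OF ab(2)]] centre_comm[OF c(3,2)] ..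
    then have "x \<oplus>\<^bsub>T\<^esub> y = fraction (s \<otimes> t) (t \<otimes> a \<oplus> s \<otimes> b)"
      unfolding x fraction_expand[OF st Lc[OF ab(1)]]
      using fraction_add[OF C_mult[OF st]] ab Lc c by simp
    moreover have "t \<otimes> a \<oplus> s \<otimes> b \<in> L"
      using left_idealD(2)[OF assms] ab c by simp
    ultimately show ?thesis unfolding fractions_def using C_mult[OF st] by blast
  qed
  show "x \<otimes>\<^bsub>T\<^esub> y \<in> fractions L" if xy: "x \<in> carrier T" "y \<in> fractions L" for x y
  proof -
    obtain s a where x: "s \<in> C" "a \<in> carrier R" "x = fraction s a"
      using xy(1) by (rule fraction_cases)
    obtain t b where y: "t \<in> C" "b \<in> L" "y = fraction t b"
      using xy(2) unfolding fractions_def by blast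
    show ?thesis
      unfolding x(3) y(3) fraction_mult[OF x(1,2) y(1) Lc[OF y(2)]] fractions_def
      using C_mult[OF x(1) y(1)] left_idealD(2)[OF assms x(2) y(2)] by blast
  qed
qed

text \<open>\<open>fractions I\<close> is a two-sided ideal of a simple ring. If it is zero, all of
  \<open>I\<close> lies in \<open>J\<close>. If it is everything, then 1 = (1/s) \<otimes> a with a
  in \<open>I\<close>, so s - a is in \<open>J\<close> and s is in both \<open>I\<close> and
  \<open>C\<close>, which is excluded.\<close>

lemma ideal_disjoint_denoms:
  assumes I: "ideal I R" and JI: "J \<subseteq> I" and disj: "I \<inter> C = {}"
  shows "I = J"
proof -
  interpret I: ideal I R by (rule I)
  have "left_ideal I R"
    using I.I_l_closed I.additive_subgroup_axioms by (simp add: left_ideal_def)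
  then have L: "left_ideal (fractions I) T" by (rule left_ideal_fractions)
  have r: "x \<otimes>\<^bsub>T\<^esub> y \<in> fractions I" if xy: "x \<in> fractions I" "y \<in> carrier T" for x y
  proof -
    obtain t b where y: "t \<in> C" "b \<in> carrier R" "y = fraction t b"
      using xy(2) by (rule fraction_cases)
    obtain s a where x: "s \<in> C" "a \<in> I" "x = fraction s a"
      using xy(1) unfolding fractions_def by blast
    show ?thesis
      unfolding x(3) y(3) fraction_mult[OF x(1) I.Icarr[OF x(2)] y(1,2)] fractions_def
      using C_mult[OF x(1) y(1)] I.I_r_closed[OF x(2) y(2)] by blast
  qed
  have "ideal (fractions I) T"
  proof (rule idealI[OF T.ring_axioms])
    show "subgroup (fractions I) (add_monoid T)"
      using left_idealD(1)[OF L] by (simp add: additive_subgroup_def)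
  qed (use left_idealD(2)[OF L] r in blast)+
  then have "fractions I = {\<zero>\<^bsub>T\<^esub>} \<or> fractions I = carrier T"
    using simple_T unfolding simple_ring_def by blast
  then show ?thesis
  proof
    assume z: "fractions I = {\<zero>\<^bsub>T\<^esub>}"
    have "a \<in> J" if "a \<in> I" for a
    proof -
      have "fraction \<one> a \<in> fractions I" unfolding fractions_def using that one_in_C by blast
      then show ?thesis
        using z fraction_eq_zero_iff[OF one_in_C I.Icarr[OF that]] by blast
    qed
    then show ?thesis using JI by blast
  next
    assume "fractions I = carrier T"
    then have "\<one>\<^bsub>T\<^esub> \<in> fractions I" by simp
    then obtain s a where sa: "s \<in> C" "a \<in> I" "\<one>\<^bsub>T\<^esub> = fraction s a"
      unfolding fractions_def by blast
    have s: "s \<in> carrier R" by (rule C_carrier[OF sa(1)])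
    \<comment> \<open>The left side is 1 written over the denominator s, so that numerators can be
      compared modulo \<open>J\<close>.\<close>
    have "fraction s s = fraction s a"
      using sa(3) fraction_one fraction_expand[OF one_in_C sa(1) one_closed] s by simp
    then have "s \<ominus> a \<in> I"
      using fraction_eq_iff[OF sa(1) s I.Icarr[OF sa(2)]] JI by blast
    then have "(s \<ominus> a) \<oplus> a \<in> I" using sa(2) by (rule I.a_closed)
    then have "s \<in> I" using s I.Icarr[OF sa(2)] by (simp add: a_minus_def a_assoc l_neg)
    then show ?thesis using disj sa(1) by blast
  qed
qed

text \<open>These are the preimages in R of the left ideals of the tensor product: closure under
  division by \<open>C\<close> is what allows \<open>L\<close> to be recovered from
  \<open>fractions L\<close>.\<close>

definition saturated where
  "saturated L \<longleftrightarrow> left_ideal L R \<and> J \<subseteq> L \<and>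
     (\<forall>c\<in>C. \<forall>r\<in>carrier R. c \<otimes> r \<in> L \<longrightarrow> r \<in> L)"

lemma saturatedD:
  assumes "saturated L"
  shows "left_ideal L R" "J \<subseteq> L" "\<lbrakk>c \<in> C; r \<in> carrier R; c \<otimes> r \<in> L\<rbrakk> \<Longrightarrow> r \<in> L"
  using assms unfolding saturated_def by blast+

text \<open>For a in \<open>L\<close>, the equality (1/1) \<otimes> a = (1/s) \<otimes> b with b in
  \<open>L'\<close> says that sa - b is in \<open>J\<close>, which lies in \<open>L'\<close>. So sa
  is in \<open>L'\<close>, and saturation of \<open>L'\<close> divides by s.\<close>

lemma saturated_fractions_inj:
  assumes L: "saturated L" "saturated L'" and eq: "fractions L = fractions L'"
  shows "L \<subseteq> L'"
proof
  fix a assume a: "a \<in> L"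
  interpret L: additive_subgroup L R by (rule left_idealD(1)[OF saturatedD(1)[OF L(1)]])
  interpret L': additive_subgroup L' R by (rule left_idealD(1)[OF saturatedD(1)[OF L(2)]])
  have ac: "a \<in> carrier R" using a L.a_subset by blast
  have "fraction \<one> a \<in> fractions L'"
    using fractionsI[OF one_in_C a] unfolding eq .
  then obtain s b where sb: "s \<in> C" "b \<in> L'" "fraction \<one> a = fraction s b"
    unfolding fractions_def by blast
  have c: "s \<in> carrier R" "b \<in> carrier R" using C_carrier[OF sb(1)] sb(2) L'.a_subset by blast+
  have "fraction s (s \<otimes> a) = fraction s b"
    using sb(3) fraction_expand[OF one_in_C sb(1) ac] c by simp
  then have "s \<otimes> a \<ominus> b \<in> L'"
    using fraction_eq_iff[OF sb(1) m_closed[OF c(1) ac] c(2)] saturatedD(2)[OF L(2)] by blast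
  then have "(s \<otimes> a \<ominus> b) \<oplus> b \<in> L'" using sb(2) by (rule L'.a_closed)
  then have "s \<otimes> a \<in> L'" using c ac by (simp add: a_minus_def a_assoc l_neg)
  then show "a \<in> L'" by (rule saturatedD(3)[OF L(2) sb(1) ac])
qed

text \<open>Without a minimal member, dependent choice gives a strictly descending sequence in the
  family. The extensions to the tensor product form a descending chain of left ideals, which becomes
  stationary, and \<open>saturated_fractions_inj\<close> turns this into two equal consecutive
  terms.\<close>

lemma saturated_minimal:
  assumes ne: "\<L> \<noteq> {}" and sat: "\<And>L. L \<in> \<L> \<Longrightarrow> saturated L"
  shows "\<exists>L\<in>\<L>. \<forall>L'\<in>\<L>. L' \<subseteq> L \<longrightarrow> L' = L"
proof (rule ccontr)
  assume *: "\<not> ?thesis"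
  have "\<exists>f. \<forall>n. f n \<in> \<L> \<and> f (Suc n) \<subset> f n"
    by (rule dependent_nat_choice) (use ne * in \<open>blast+\<close>)
  then obtain f where f: "\<And>n. f n \<in> \<L>" "\<And>n. f (Suc n) \<subset> f n" by blast
  have "left_ideal (fractions (f n)) T" for n
    by (rule left_ideal_fractions[OF saturatedD(1)[OF sat[OF f(1)]]])
  moreover have "antimono (\<lambda>n. fractions (f n))"
    unfolding antimono_iff_le_Suc fractions_def using f(2) by blast
  ultimately obtain m where m: "\<And>n. n \<ge> m \<Longrightarrow> fractions (f n) = fractions (f m)"
    using artinian_T unfolding artinian_ring_def by meson
  have "f m \<subseteq> f (Suc m)"
    using m[of "Suc m"] by (intro saturated_fractions_inj sat f(1)) simp
  then show False using f(2) by blast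
qed

end

section \<open>Modules\<close>

lemma (in left_module) submoduleI:
  assumes "N \<subseteq> carrier M" "\<zero>\<^bsub>M\<^esub> \<in> N"
    and "\<And>x y. \<lbrakk>x \<in> N; y \<in> N\<rbrakk> \<Longrightarrow> x \<oplus>\<^bsub>M\<^esub> y \<in> N"
    and s: "\<And>r x. \<lbrakk>r \<in> carrier R; x \<in> N\<rbrakk> \<Longrightarrow> r \<odot>\<^bsub>M\<^esub> x \<in> N"
  shows "submodule N R M"
proof -
  have "\<ominus>\<^bsub>M\<^esub> x \<in> N" if "x \<in> N" for x
  proof -
    have x: "x \<in> carrier M" using that assms(1) by blast
    have "\<ominus>\<^bsub>M\<^esub> x = (\<ominus>\<^bsub>R\<^esub> \<one>\<^bsub>R\<^esub>) \<odot>\<^bsub>M\<^esub> x"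
      using smult_l_minus[of "\<one>\<^bsub>R\<^esub>" x] smult_one x by simp
    then show ?thesis using s that by simp
  qed
  then show ?thesis
    using assms by (intro submodule.intro subgroup.intro submodule_axioms.intro)
      (auto simp flip: a_inv_def)
qed

lemma (in left_module) left_module_submodule:
  assumes "submodule N R M"
  shows "left_module R (M\<lparr>carrier := N\<rparr>)"
proof -
  interpret N: submodule N R M by (rule assms)
  have Nc: "x \<in> carrier M" if "x \<in> N" for x using that N.subset by auto
  have "abelian_group (M\<lparr>carrier := N\<rparr>)"
  proof (rule abelian_groupI)
    fix x assume x: "x \<in> carrier (M\<lparr>carrier := N\<rparr>)"
    have "\<ominus>\<^bsub>M\<^esub> x \<in> N" using N.m_inv_closed[of x] x by (simp add: a_inv_def)
    then show "\<exists>y\<in>carrier (M\<lparr>carrier := N\<rparr>). y \<oplus>\<^bsub>M\<lparr>carrier := N\<rparr>\<^esub> x = \<zero>\<^bsub>M\<lparr>carrier := N\<rparr>\<^esub>"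
      using x Nc M.l_neg by auto
  qed (use N.m_closed N.one_closed Nc in \<open>auto simp: M.a_ac\<close>)
  then show ?thesis
    by (intro left_module.intro left_module_axioms.intro R.ring_axioms)
      (auto simp: Nc smult_l_distr smult_r_distr smult_assoc1 smult_one)
qed

lemma (in left_module) submodule_left_ideal_image:
  assumes L: "left_ideal L R" and m: "m \<in> carrier M"
  shows "submodule ((\<lambda>r. r \<odot>\<^bsub>M\<^esub> m) ` L) R M"
proof -
  interpret L: additive_subgroup L R by (rule left_idealD[OF L])
  have Lc: "x \<in> carrier R" if "x \<in> L" for x using that L.a_subset by blast
  show ?thesis
  proof (rule submoduleI)
    show "(\<lambda>r. r \<odot>\<^bsub>M\<^esub> m) ` L \<subseteq> carrier M" using Lc smult_closed m by blast
    show "\<zero>\<^bsub>M\<^esub> \<in> (\<lambda>r. r \<odot>\<^bsub>M\<^esub> m) ` L"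
      using smult_l_null[OF m] L.zero_closed by (intro rev_image_eqI[of "\<zero>\<^bsub>R\<^esub>"]) simp_all
  next
    fix x y assume "x \<in> (\<lambda>r. r \<odot>\<^bsub>M\<^esub> m) ` L" "y \<in> (\<lambda>r. r \<odot>\<^bsub>M\<^esub> m) ` L"
    then obtain a b where "a \<in> L" "b \<in> L" "x = a \<odot>\<^bsub>M\<^esub> m" "y = b \<odot>\<^bsub>M\<^esub> m" by blast
    then show "x \<oplus>\<^bsub>M\<^esub> y \<in> (\<lambda>r. r \<odot>\<^bsub>M\<^esub> m) ` L"
      using Lc m by (intro rev_image_eqI[of "a \<oplus>\<^bsub>R\<^esub> b"]) (simp_all add: smult_l_distr)
  next
    fix r x assume "r \<in> carrier R" "x \<in> (\<lambda>r. r \<odot>\<^bsub>M\<^esub> m) ` L"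
    then obtain a where "a \<in> L" "x = a \<odot>\<^bsub>M\<^esub> m" by blast
    then show "r \<odot>\<^bsub>M\<^esub> x \<in> (\<lambda>r. r \<odot>\<^bsub>M\<^esub> m) ` L"
      using Lc m \<open>r \<in> carrier R\<close> left_idealD(2)[OF L]
      by (intro rev_image_eqI[of "r \<otimes>\<^bsub>R\<^esub> a"]) (simp_all add: smult_assoc1)
  qed
qed

lemma (in left_module) smult_minus_l:
  assumes "a \<in> carrier R" "b \<in> carrier R" "m \<in> carrier M"
  shows "(a \<ominus>\<^bsub>R\<^esub> b) \<odot>\<^bsub>M\<^esub> m = a \<odot>\<^bsub>M\<^esub> m \<ominus>\<^bsub>M\<^esub> b \<odot>\<^bsub>M\<^esub> m"
  using assms by (simp add: R.minus_eq M.minus_eq smult_l_distr smult_l_minus)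

section \<open>Simple modules: prime annihilators and the action of the centre\<close>

locale simple_module = left_module +
  assumes simple: "simple_left_module R M"
begin

lemma submodule_trivial: "submodule N R M \<Longrightarrow> N = {\<zero>\<^bsub>M\<^esub>} \<or> N = carrier M"
  using simple by (simp add: simple_left_module_def)

lemma nontrivial: "carrier M \<noteq> {\<zero>\<^bsub>M\<^esub>}"
  using simple by (simp add: simple_left_module_def)

lemma ideal_annihilator: "ideal (annihilator R M) R"
proof (rule idealI[OF R.ring_axioms])
  show "subgroup (annihilator R M) (add_monoid R)"
    by (intro subgroup.intro)
       (auto simp: annihilator_def smult_l_distr smult_l_null smult_l_minus simp flip: a_inv_def)
qed (auto simp: annihilator_def smult_assoc1 smult_closed smult_r_null)

text \<open>If \<open>J\<close> does not annihilate the module, some m has Jm nonzero, so Jm is the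
  whole module by simplicity, and IM = IJm = 0.\<close>

lemma prime_annihilator: "prime_ideal_nc R (annihilator R M)"
  unfolding prime_ideal_nc_def
proof (intro conjI allI impI)
  show "ideal (annihilator R M) R" by (rule ideal_annihilator)
  show "annihilator R M \<noteq> carrier R"
  proof
    assume "annihilator R M = carrier R"
    then have "\<one>\<^bsub>R\<^esub> \<in> annihilator R M" by simp
    then have "carrier M \<subseteq> {\<zero>\<^bsub>M\<^esub>}" by (auto simp: annihilator_def smult_one)
    then show False using nontrivial M.zero_closed by blast
  qed
  fix I J assume I: "ideal I R" and J: "ideal J R" and IJ: "I \<cdot>\<^bsub>R\<^esub> J \<subseteq> annihilator R M"
  interpret I: ideal I R by (rule I)
  interpret J: ideal J R by (rule J)
  show "I \<subseteq> annihilator R M \<or> J \<subseteq> annihilator R M"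
  proof (rule disjCI)
    assume "\<not> J \<subseteq> annihilator R M"
    then obtain j m where jm: "j \<in> J" "m \<in> carrier M" "j \<odot>\<^bsub>M\<^esub> m \<noteq> \<zero>\<^bsub>M\<^esub>"
      using J.Icarr unfolding annihilator_def by blast
    have "left_ideal J R" using J.additive_subgroup_axioms J.I_l_closed by (simp add: left_ideal_def)
    then have JM: "(\<lambda>r. r \<odot>\<^bsub>M\<^esub> m) ` J = carrier M"
      using submodule_trivial[OF submodule_left_ideal_image[OF _ jm(2)]] jm by blast
    show "I \<subseteq> annihilator R M"
    proof
      fix i assume i: "i \<in> I"
      have "i \<odot>\<^bsub>M\<^esub> x = \<zero>\<^bsub>M\<^esub>" if x: "x \<in> carrier M" for x
      proof -
        obtain a where a: "a \<in> J" "x = a \<odot>\<^bsub>M\<^esub> m" using x unfolding JM[symmetric] by blast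
        have "i \<otimes>\<^bsub>R\<^esub> a \<in> annihilator R M" using IJ ideal_prod.prod[OF i a(1)] by blast
        then show ?thesis
          using a i jm(2) smult_assoc1[of i a m] I.Icarr J.Icarr by (simp add: annihilator_def)
      qed
      then show "i \<in> annihilator R M" using i I.Icarr by (simp add: annihilator_def)
    qed
  qed
qed

text \<open>The argument of Schur's lemma: multiplication by a central element is a module
  endomorphism. It is nonzero, so its kernel is zero and its image is everything.\<close>

lemma central_smult_bij:
  assumes c: "c \<in> centre R" "c \<notin> annihilator R M"
  shows central_smult_inj: "\<And>x. \<lbrakk>x \<in> carrier M; c \<odot>\<^bsub>M\<^esub> x = \<zero>\<^bsub>M\<^esub>\<rbrakk> \<Longrightarrow> x = \<zero>\<^bsub>M\<^esub>"
    and central_smult_surj: "\<And>y. y \<in> carrier M \<Longrightarrow> \<exists>x\<in>carrier M. y = c \<odot>\<^bsub>M\<^esub> x"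
proof -
  have cc: "c \<in> carrier R" using c by (simp add: centre_def)
  have comm: "c \<odot>\<^bsub>M\<^esub> (r \<odot>\<^bsub>M\<^esub> x) = r \<odot>\<^bsub>M\<^esub> (c \<odot>\<^bsub>M\<^esub> x)" if "r \<in> carrier R" "x \<in> carrier M" for r x
  proof -
    have "c \<otimes>\<^bsub>R\<^esub> r = r \<otimes>\<^bsub>R\<^esub> c" using c that unfolding centre_def by blast
    then show ?thesis using smult_assoc1[OF cc that] smult_assoc1[OF that(1) cc that(2)] by metis
  qed
  obtain m where m: "m \<in> carrier M" "c \<odot>\<^bsub>M\<^esub> m \<noteq> \<zero>\<^bsub>M\<^esub>"
    using c(2) cc by (auto simp: annihilator_def)
  have "submodule {x \<in> carrier M. c \<odot>\<^bsub>M\<^esub> x = \<zero>\<^bsub>M\<^esub>} R M"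
    using cc by (intro submoduleI) (auto simp: smult_r_null smult_r_distr smult_closed comm)
  then have "{x \<in> carrier M. c \<odot>\<^bsub>M\<^esub> x = \<zero>\<^bsub>M\<^esub>} = {\<zero>\<^bsub>M\<^esub>}"
    using submodule_trivial m by blast
  then show "x = \<zero>\<^bsub>M\<^esub>" if "x \<in> carrier M" "c \<odot>\<^bsub>M\<^esub> x = \<zero>\<^bsub>M\<^esub>" for x
    using that by blast
  have "submodule ((\<lambda>x. c \<odot>\<^bsub>M\<^esub> x) ` carrier M) R M"
  proof (rule submoduleI)
    show "\<zero>\<^bsub>M\<^esub> \<in> (\<lambda>x. c \<odot>\<^bsub>M\<^esub> x) ` carrier M"
      using smult_r_null[OF cc] by (intro rev_image_eqI[of "\<zero>\<^bsub>M\<^esub>"]) simp_all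
  next
    fix x y assume "x \<in> (\<lambda>x. c \<odot>\<^bsub>M\<^esub> x) ` carrier M" "y \<in> (\<lambda>x. c \<odot>\<^bsub>M\<^esub> x) ` carrier M"
    then obtain u v where "u \<in> carrier M" "v \<in> carrier M" "x = c \<odot>\<^bsub>M\<^esub> u" "y = c \<odot>\<^bsub>M\<^esub> v" by blast
    then show "x \<oplus>\<^bsub>M\<^esub> y \<in> (\<lambda>x. c \<odot>\<^bsub>M\<^esub> x) ` carrier M"
      using cc by (intro rev_image_eqI[of "u \<oplus>\<^bsub>M\<^esub> v"]) (simp_all add: smult_r_distr)
  next
    fix r x assume r: "r \<in> carrier R" and "x \<in> (\<lambda>x. c \<odot>\<^bsub>M\<^esub> x) ` carrier M"
    then obtain u where "u \<in> carrier M" "x = c \<odot>\<^bsub>M\<^esub> u" by blast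
    then show "r \<odot>\<^bsub>M\<^esub> x \<in> (\<lambda>x. c \<odot>\<^bsub>M\<^esub> x) ` carrier M"
      using r by (intro rev_image_eqI[of "r \<odot>\<^bsub>M\<^esub> u"]) (simp_all add: smult_closed comm)
  qed (use cc smult_closed in auto)
  then have "(\<lambda>x. c \<odot>\<^bsub>M\<^esub> x) ` carrier M = carrier M"
    using submodule_trivial m by blast
  then show "\<exists>x\<in>carrier M. y = c \<odot>\<^bsub>M\<^esub> x" if "y \<in> carrier M" for y
    using that by blast
qed

end

lemma simple_moduleI: "simple_left_module R M \<Longrightarrow> simple_module R M"
  by (simp add: simple_module_def simple_module_axioms_def simple_left_module_def)

section \<open>Simple modules whose annihilator lies over \<pp>\<close>

context simple_artinian_fibre
begin

text \<open>The annihilator is an ideal that contains \<pp>, hence \<open>J\<close>, and misses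
  \<open>C\<close>. By \<open>ideal_disjoint_denoms\<close> only \<open>J\<close> itself has these
  properties.\<close>

lemma annihilator_eq_extended:
  assumes M: "simple_left_module R M" and ann: "annihilator R M \<inter> centre R = \<pp>"
  shows "annihilator R M = J"
proof -
  interpret M: simple_module R M by (rule simple_moduleI[OF M])
  interpret P: ideal "annihilator R M" R by (rule M.ideal_annihilator)
  have "x \<in> annihilator R M" if "x \<in> J" for x
    using that
  proof (induction rule: ideal_prod.induct)
    case (prod i j)
    then show ?case using ann P.I_l_closed by blast
  next
    case (sum s1 s2)
    then show ?case by simp
  qed
  then show ?thesis
    using ann by (intro ideal_disjoint_denoms P.ideal_axioms) blast+
qed

text \<open>The annihilators of the finite subsets of \<open>M\<close> are saturated, so a minimal one exists; it is
  \<open>R\<pp>\<close>, i.e. \<open>R/R\<pp>\<close> embeds into a finite power of \<open>M\<close>. As \<open>c\<close> is bijective on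
  \<open>M\<close>, it is then surjective on \<open>R/R\<pp>\<close>, by induction on the size of the finite set.\<close>

lemma simple_module_denoms_invertible:
  assumes M: "simple_left_module R M" and ann: "annihilator R M \<inter> centre R = \<pp>" and c: "c \<in> C"
  shows "\<exists>r\<in>carrier R. \<one> \<ominus> c \<otimes> r \<in> J"
proof -
  interpret M: simple_module R M by (rule simple_moduleI[OF M])
  note P = annihilator_eq_extended[OF M ann]
  have notP: "d \<in> centre R" "d \<notin> annihilator R M" if "d \<in> C" for d
    using that ann by blast+
  define annih where "annih V = {a \<in> carrier R. \<forall>m\<in>V. a \<odot>\<^bsub>M\<^esub> m = \<zero>\<^bsub>M\<^esub>}" for V
  have annih_left: "left_ideal (annih V) R" if "V \<subseteq> carrier M" for V
    unfolding annih_def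
  proof (rule left_idealI)
    show "r \<otimes> x \<in> {a \<in> carrier R. \<forall>m\<in>V. a \<odot>\<^bsub>M\<^esub> m = \<zero>\<^bsub>M\<^esub>}"
      if "r \<in> carrier R" "x \<in> {a \<in> carrier R. \<forall>m\<in>V. a \<odot>\<^bsub>M\<^esub> m = \<zero>\<^bsub>M\<^esub>}" for r x
      using that \<open>V \<subseteq> carrier M\<close> M.smult_assoc1 M.smult_r_null by (auto simp: subset_iff)
  qed (use that in \<open>auto simp: subset_iff M.smult_l_null M.smult_l_distr\<close>)
  have annih_sat: "saturated (annih V)" if V: "V \<subseteq> carrier M" for V
    unfolding saturated_def
  proof (intro conjI ballI impI annih_left[OF V])
    show "J \<subseteq> annih V"
      unfolding P[symmetric] annih_def annihilator_def using V by blast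
    fix d r assume d: "d \<in> C" and r: "r \<in> carrier R" and dr: "d \<otimes> r \<in> annih V"
    have "r \<odot>\<^bsub>M\<^esub> m = \<zero>\<^bsub>M\<^esub>" if "m \<in> V" for m
    proof -
      have m: "m \<in> carrier M" using V that by blast
      have "d \<odot>\<^bsub>M\<^esub> (r \<odot>\<^bsub>M\<^esub> m) = \<zero>\<^bsub>M\<^esub>"
        using dr that M.smult_assoc1[OF C_carrier[OF d] r m] unfolding annih_def by simp
      then show ?thesis
        by (rule M.central_smult_inj[OF notP[OF d] M.smult_closed[OF r m]])
    qed
    then show "r \<in> annih V" using r by (simp add: annih_def)
  qed
  have ne: "annih ` {V. finite V \<and> V \<subseteq> carrier M} \<noteq> {}"
    unfolding image_is_empty by blast
  have "saturated L" if "L \<in> annih ` {V. finite V \<and> V \<subseteq> carrier M}" for L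
    using that annih_sat by blast
  from saturated_minimal[OF ne this]
  obtain L where L: "L \<in> annih ` {V. finite V \<and> V \<subseteq> carrier M}"
    and min: "\<forall>L'\<in>annih ` {V. finite V \<and> V \<subseteq> carrier M}. L' \<subseteq> L \<longrightarrow> L' = L" ..
  from L obtain V where V: "finite V" "V \<subseteq> carrier M" "L = annih V" by blast
  \<comment> \<open>By minimality, adding any m to \<open>V\<close> leaves the annihilator equal to
    \<open>L\<close>. So \<open>L\<close> kills every m and lies in the annihilator of the module,
    which is \<open>J\<close>.\<close>
  have LJ: "L \<subseteq> J"
  proof
    fix a assume a: "a \<in> L"
    have "a \<odot>\<^bsub>M\<^esub> m = \<zero>\<^bsub>M\<^esub>" if m: "m \<in> carrier M" for m
    proof -
      have "annih (insert m V) = L"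
      proof (rule min[rule_format])
        show "annih (insert m V) \<in> annih ` {V. finite V \<and> V \<subseteq> carrier M}"
          using V m by (intro imageI) simp
        show "annih (insert m V) \<subseteq> L" unfolding V(3) annih_def by blast
      qed
      then show ?thesis using a unfolding annih_def by blast
    qed
    then show "a \<in> J"
      using a unfolding P[symmetric] V(3) annih_def annihilator_def by blast
  qed
  have cc: "c \<in> carrier R" by (rule C_carrier[OF c])
  \<comment> \<open>Every element is divisible by c modulo the annihilator of a finite set. For the
    set chosen above, whose annihilator lies in \<open>J\<close>, the case a = 1 is the
    claim.\<close>
  have "\<forall>a\<in>carrier R. \<exists>b\<in>carrier R. a \<ominus> c \<otimes> b \<in> annih V"
    using V(1,2)
  proof (induction V rule: finite_induct)
    case empty
    then show ?case using cc by (auto simp: annih_def)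
  next
    case (insert m V)
    have m: "m \<in> carrier M" and Vc: "V \<subseteq> carrier M" using insert.prems by blast+
    interpret W: additive_subgroup "annih V" R by (rule left_idealD(1)[OF annih_left[OF Vc]])
    show ?case
    proof
      fix a assume a: "a \<in> carrier R"
      obtain b where b: "b \<in> carrier R" "a \<ominus> c \<otimes> b \<in> annih V"
        using insert.IH Vc a by blast
      define a' where "a' = a \<ominus> c \<otimes> b"
      have a': "a' \<in> annih V" "a' \<in> carrier R" using b a cc unfolding a'_def by auto
      \<comment> \<open>The remainder a' kills \<open>V\<close>, but may fail to kill the new
        element m. Simplicity leaves two cases: either everything that kills \<open>V\<close> kills
        m as well, or m can be moved to any element of the module by something that kills
        \<open>V\<close>.\<close>
      have "(\<lambda>r. r \<odot>\<^bsub>M\<^esub> m) ` annih V = {\<zero>\<^bsub>M\<^esub>} \<or> (\<lambda>r. r \<odot>\<^bsub>M\<^esub> m) ` annih V = carrier M"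
        by (rule M.submodule_trivial[OF M.submodule_left_ideal_image[OF annih_left[OF Vc] m]])
      then show "\<exists>b\<in>carrier R. a \<ominus> c \<otimes> b \<in> annih (insert m V)"
      proof
        assume "(\<lambda>r. r \<odot>\<^bsub>M\<^esub> m) ` annih V = {\<zero>\<^bsub>M\<^esub>}"
        then have "a' \<odot>\<^bsub>M\<^esub> m = \<zero>\<^bsub>M\<^esub>" using a'(1) by blast
        then have "a' \<in> annih (insert m V)" using a' unfolding annih_def by blast
        then show ?thesis using b(1) unfolding a'_def by blast
      next
        assume full: "(\<lambda>r. r \<odot>\<^bsub>M\<^esub> m) ` annih V = carrier M"
        \<comment> \<open>The correction b' is chosen with cb'm = a'm: first a'm is divided by c
          inside the module, then the quotient is reached from m within \<open>annih V\<close>, so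
          that a' - cb' still kills \<open>V\<close>.\<close>
        obtain x where x: "x \<in> carrier M" "a' \<odot>\<^bsub>M\<^esub> m = c \<odot>\<^bsub>M\<^esub> x"
          using M.central_smult_surj[OF notP[OF c] M.smult_closed[OF a'(2) m]] by blast
        obtain b' where b': "b' \<in> annih V" "x = b' \<odot>\<^bsub>M\<^esub> m"
          using x(1) unfolding full[symmetric] by blast
        have b'c: "b' \<in> carrier R" using b'(1) unfolding annih_def by blast
        have eq: "a \<ominus> c \<otimes> (b \<oplus> b') = a' \<ominus> c \<otimes> b'"
          unfolding a'_def using a b(1) b'c cc
          by (simp add: a_minus_def r_distr minus_add a_assoc)
        have "a' \<ominus> c \<otimes> b' \<in> annih V"
          using a'(1) left_idealD(2)[OF annih_left[OF Vc] cc b'(1)] by (simp add: a_minus_def)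
        moreover have "(a' \<ominus> c \<otimes> b') \<odot>\<^bsub>M\<^esub> m = \<zero>\<^bsub>M\<^esub>"
          using M.smult_minus_l[OF a'(2) m_closed[OF cc b'c] m] M.smult_assoc1[OF cc b'c m]
            x b'(2) M.smult_closed[OF cc x(1)] by (simp add: M.M.r_neg a_minus_def)
        ultimately have "a \<ominus> c \<otimes> (b \<oplus> b') \<in> annih (insert m V)"
          unfolding eq annih_def by blast
        then show ?thesis using b(1) b'c by blast
      qed
    qed
  qed
  then show ?thesis using LJ V(3) one_closed by blast
qed

end

section \<open>The socle of the fibre\<close>

lemma quotient_module_sel:
  "carrier (quotient_module R I) = a_rcosets\<^bsub>R\<^esub> I"
  "X \<oplus>\<^bsub>quotient_module R I\<^esub> Y = X <+>\<^bsub>R\<^esub> Y"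
  "\<zero>\<^bsub>quotient_module R I\<^esub> = I"
  by (simp_all add: quotient_module_def)

text \<open>The scalar action is a union over the representatives of a coset. They differ by
  elements i of \<open>I\<close>, and ri is again in \<open>I\<close>, so all of them yield the same
  coset.\<close>

lemma (in ideal) quotient_module_smult:
  assumes "r \<in> carrier R" "a \<in> carrier R"
  shows "r \<odot>\<^bsub>quotient_module R I\<^esub> (I +> a) = I +> (r \<otimes> a)"
proof -
  have const: "I +> (r \<otimes> x) = I +> (r \<otimes> a)" if x: "x \<in> I +> a" for x
  proof -
    obtain i where i: "i \<in> I" "x = i \<oplus> a" using x unfolding a_r_coset_def' by blast
    have "r \<otimes> x \<ominus> r \<otimes> a = r \<otimes> i"
      using assms i Icarr by (simp add: r_distr a_minus_def a_assoc r_neg)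
    then have "r \<otimes> x \<ominus> r \<otimes> a \<in> I" using I_l_closed[OF i(1) assms(1)] by simp
    then show ?thesis
      using quotient_eq_iff_same_a_r_cos[OF ideal_axioms, of "r \<otimes> x" "r \<otimes> a"] assms i Icarr by simp
  qed
  have "(\<Union>x\<in>I +> a. I +> (r \<otimes> x)) = I +> (r \<otimes> a)"
    by (rule Union_const_on[OF a_rcos_self[OF assms(2)] const])
  then show ?thesis
    unfolding quotient_module_def module.select_convs .
qed

lemma (in ideal) left_module_quotient: "left_module R (quotient_module R I)"
proof -
  interpret Q: ring "R Quot I" by (rule quotient_is_ring)
  have car: "carrier (quotient_module R I) = (\<lambda>a. I +> a) ` carrier R"
    unfolding quotient_module_sel A_RCOSETS_def' by blast
  have add: "(I +> a) \<oplus>\<^bsub>quotient_module R I\<^esub> (I +> b) = I +> (a \<oplus> b)"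
    if "a \<in> carrier R" "b \<in> carrier R" for a b
    unfolding quotient_module_sel using that by (rule a_rcos_sum)
  have zero: "\<zero>\<^bsub>quotient_module R I\<^esub> = I +> \<zero>"
    unfolding quotient_module_sel by (simp add: a_subset)
  have "abelian_group (quotient_module R I)"
  proof (rule abelian_groupI)
    fix x assume "x \<in> carrier (quotient_module R I)"
    then obtain a where a: "a \<in> carrier R" "x = I +> a" unfolding car by blast
    then show "\<exists>y\<in>carrier (quotient_module R I). y \<oplus>\<^bsub>quotient_module R I\<^esub> x = \<zero>\<^bsub>quotient_module R I\<^esub>"
      unfolding zero car by (intro bexI[of _ "I +> (\<ominus> a)"]) (simp_all add: add l_neg)
  qed (auto simp: car add zero a_ac simp del: a_coset_add_zero)
  then show ?thesis
    by (intro left_module.intro left_module_axioms.intro ring_axioms)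
      (auto simp: car add quotient_module_smult l_distr r_distr m_assoc)
qed

context torsion_free_fibre
begin

abbreviation "Q \<equiv> quotient_module R J"

sublocale Q: left_module R Q
  by (rule J.left_module_quotient)

lemma carrier_Q: "carrier Q = g ` carrier R"
  unfolding quotient_module_sel A_RCOSETS_def' by blast

lemma Q_zero_iff: "a \<in> carrier R \<Longrightarrow> g a = \<zero>\<^bsub>Q\<^esub> \<longleftrightarrow> a \<in> J"
  using g_eq_zero_iff[of a] unfolding quotient_module_sel FactRing_sel .

text \<open>A central z that kills a nonzero class \<open>g a\<close> satisfies za \<in>
  \<open>J\<close>, and regularity excludes z from \<open>C\<close>. Conversely \<pp> lies in the
  two-sided ideal \<open>J\<close> and kills all of R/J.\<close>

lemma annihilator_submodule_quotient:
  assumes U: "submodule U R Q" and ne: "U \<noteq> {\<zero>\<^bsub>Q\<^esub>}"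
  shows "annihilator R (Q\<lparr>carrier := U\<rparr>) \<inter> centre R = \<pp>"
proof -
  interpret U: submodule U R Q by (rule U)
  have Nc: "\<exists>a\<in>carrier R. x = g a" if "x \<in> U" for x
    using U.subset that carrier_Q by auto
  have "\<zero>\<^bsub>Q\<^esub> \<in> U" using U.one_closed by simp
  then obtain x where x: "x \<in> U" "x \<noteq> \<zero>\<^bsub>Q\<^esub>" using ne by blast
  then obtain a where a: "a \<in> carrier R" "x = g a" using Nc by blast
  show ?thesis
  proof (intro equalityI subsetI)
    fix z assume z: "z \<in> annihilator R (Q\<lparr>carrier := U\<rparr>) \<inter> centre R"
    then have zc: "z \<in> carrier R" "z \<in> centre R" using centre_carrier by blast+
    have "z \<odot>\<^bsub>Q\<^esub> x = \<zero>\<^bsub>Q\<^esub>" using z x(1) by (simp add: annihilator_def)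
    then have "z \<otimes> a \<in> J"
      unfolding a(2) J.quotient_module_smult[OF zc(1) a(1)]
      using Q_zero_iff[OF m_closed[OF zc(1) a(1)]] by blast
    then show "z \<in> \<pp>"
      using C_regular[of z a] a x(2) Q_zero_iff[OF a(1)] zc by blast
  next
    fix z assume z: "z \<in> \<pp>"
    have zc: "z \<in> carrier R" "z \<in> centre R" "z \<in> J"
      using z prime_subset_centre centre_carrier extended_inter_centre by blast+
    have "z \<odot>\<^bsub>Q\<^esub> y = \<zero>\<^bsub>Q\<^esub>" if y: "y \<in> U" for y
    proof -
      obtain b where b: "b \<in> carrier R" "y = g b" using Nc[OF y] by blast
      show ?thesis
        unfolding b(2) J.quotient_module_smult[OF zc(1) b(1)]
        using Q_zero_iff[OF m_closed[OF zc(1) b(1)]] J.I_r_closed[OF zc(3) b(1)] by blast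
    qed
    then show "z \<in> annihilator R (Q\<lparr>carrier := U\<rparr>) \<inter> centre R"
      using zc by (simp add: annihilator_def)
  qed
qed

text \<open>A simple submodule of R/J would have an annihilator lying over \<pp>, and the PLM
  property would make \<pp> maximal. So the socle is the subgroup generated by the empty
  set.\<close>

lemma PLM_socle_zero:
  assumes PLM: "PLM_ring R" and nmax: "\<pp> \<notin> Max_centre R"
  shows "socle R Q = {\<zero>\<^bsub>Q\<^esub>}"
proof -
  have "\<not> simple_left_module R (Q\<lparr>carrier := U\<rparr>)" if U: "submodule U R Q" for U
  proof
    assume s: "simple_left_module R (Q\<lparr>carrier := U\<rparr>)"
    then have "U \<noteq> {\<zero>\<^bsub>Q\<^esub>}" by (simp add: simple_left_module_def)
    then show False
      using PLM_ringD[OF PLM s] annihilator_submodule_quotient[OF U] nmax by simp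
  qed
  then have none: "{U. submodule U R Q \<and> simple_left_module R (Q\<lparr>carrier := U\<rparr>)} = {}" by blast
  have "socle R Q = generate (add_monoid Q) {}"
    unfolding socle_def none Union_empty by (rule refl)
  also have "\<dots> = {\<zero>\<^bsub>Q\<^esub>}"
    using group.generate_empty[OF Q.M.a_group] by simp
  finally show ?thesis .
qed

end

section \<open>Minimal left ideals above \<open>J\<close> and the nonvanishing of the socle\<close>

context simple_artinian_fibre
begin

text \<open>Submodules of L/J correspond to left ideals between \<open>J\<close> and
  \<open>L\<close>, of which minimality leaves only the two ends.\<close>

lemma minimal_left_ideal_simple:
  assumes L: "left_ideal L R" "J \<subset> L"
    and min: "\<And>L'. \<lbrakk>left_ideal L' R; J \<subset> L'; L' \<subseteq> L\<rbrakk> \<Longrightarrow> L' = L"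
  shows "submodule (g ` L) R Q" "simple_left_module R (Q\<lparr>carrier := g ` L\<rparr>)" "g ` L \<noteq> {\<zero>\<^bsub>Q\<^esub>}"
proof -
  interpret L: additive_subgroup L R by (rule left_idealD(1)[OF L(1)])
  have Lc: "a \<in> carrier R" if "a \<in> L" for a using that L.a_subset by blast
  have gadd: "g a \<oplus>\<^bsub>Q\<^esub> g b = g (a \<oplus> b)" if "a \<in> carrier R" "b \<in> carrier R" for a b
    unfolding quotient_module_sel using that by (rule J.a_rcos_sum)
  have zero: "\<zero>\<^bsub>Q\<^esub> = g \<zero>" using Q_zero_iff[OF zero_closed] by simp
  show sub: "submodule (g ` L) R Q"
  proof (rule Q.submoduleI)
    show "g ` L \<subseteq> carrier Q" unfolding carrier_Q using Lc by blast
    show "\<zero>\<^bsub>Q\<^esub> \<in> g ` L" unfolding zero using L.zero_closed by blast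
  next
    fix x y assume "x \<in> g ` L" "y \<in> g ` L"
    then obtain a b where ab: "a \<in> L" "b \<in> L" "x = g a" "y = g b" by blast
    show "x \<oplus>\<^bsub>Q\<^esub> y \<in> g ` L"
      unfolding ab(3,4) gadd[OF Lc[OF ab(1)] Lc[OF ab(2)]] using L.a_closed[OF ab(1,2)] by (rule imageI)
  next
    fix r x assume r: "r \<in> carrier R" and "x \<in> g ` L"
    then obtain a where a: "a \<in> L" "x = g a" by blast
    show "r \<odot>\<^bsub>Q\<^esub> x \<in> g ` L"
      unfolding a(2) J.quotient_module_smult[OF r Lc[OF a(1)]]
      using left_idealD(2)[OF L(1) r a(1)] by (rule imageI)
  qed
  obtain l where l: "l \<in> L" "l \<notin> J" using L(2) by blast
  show ne: "g ` L \<noteq> {\<zero>\<^bsub>Q\<^esub>}"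
    using Q_zero_iff[OF Lc[OF l(1)]] l by blast
  have "U = {\<zero>\<^bsub>Q\<^esub>} \<or> U = g ` L" if U: "submodule U R (Q\<lparr>carrier := g ` L\<rparr>)" for U
  proof -
    interpret U: submodule U R "Q\<lparr>carrier := g ` L\<rparr>" by (rule U)
    have NL: "U \<subseteq> g ` L" using U.subset by simp
    have N0: "\<zero>\<^bsub>Q\<^esub> \<in> U" using U.one_closed by simp
    \<comment> \<open>The full preimage of \<open>U\<close> in R. It stays inside \<open>L\<close>
      because \<open>L\<close> contains \<open>J\<close>.\<close>
    define L' where "L' = {a \<in> carrier R. g a \<in> U}"
    have NL': "U = g ` L'"
      using NL Lc unfolding L'_def by blast
    have "left_ideal L' R"
    proof (rule left_idealI)
      show "\<zero> \<in> L'" using N0 unfolding L'_def zero by simp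
    next
      fix x y assume "x \<in> L'" "y \<in> L'"
      then show "x \<oplus> y \<in> L'"
        using U.m_closed[of "g x" "g y"] gadd[of x y] by (simp add: L'_def)
    next
      fix r x assume "r \<in> carrier R" "x \<in> L'"
      then show "r \<otimes> x \<in> L'"
        using U.smult_closed[of r "g x"] J.quotient_module_smult[of r x] by (simp add: L'_def)
    qed (auto simp: L'_def)
    moreover have JL': "J \<subseteq> L'"
    proof
      fix x assume x: "x \<in> J"
      then show "x \<in> L'"
        using N0 Q_zero_iff[OF J.Icarr[OF x]] J.Icarr[OF x] unfolding L'_def by simp
    qed
    moreover have "L' \<subseteq> L"
    proof
      fix a assume "a \<in> L'"
      then have a: "a \<in> carrier R" "g a \<in> g ` L" using NL unfolding L'_def by blast+
      then obtain b where b: "b \<in> L" "g a = g b" by blast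
      then have "a \<ominus> b \<in> L" using g_eq_iff[OF a(1) Lc[OF b(1)]] L(2) by blast
      then have "(a \<ominus> b) \<oplus> b \<in> L" using b(1) by (rule L.a_closed)
      then show "a \<in> L" using a(1) Lc[OF b(1)] by (simp add: a_minus_def a_assoc l_neg)
    qed
    ultimately have "L' = J \<or> L' = L" using min by blast
    then show ?thesis
    proof
      assume "L' = J"
      then have "U \<subseteq> {\<zero>\<^bsub>Q\<^esub>}" unfolding NL' using Q_zero_iff J.Icarr by blast
      then show ?thesis using N0 by blast
    next
      assume "L' = L"
      then show ?thesis unfolding NL' by blast
    qed
  qed
  then show "simple_left_module R (Q\<lparr>carrier := g ` L\<rparr>)"
    unfolding simple_left_module_def using Q.left_module_submodule[OF sub] ne by simp
qed

text \<open>Invertibility of \<open>C\<close> modulo \<open>J\<close> makes every left ideal above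
  \<open>J\<close> saturated. The minimum condition thus applies to the left ideals strictly above
  \<open>J\<close>, and a minimal one gives a simple submodule of R/J.\<close>

lemma denoms_invertible_socle:
  assumes inv: "\<forall>c\<in>C. \<exists>r\<in>carrier R. \<one> \<ominus> c \<otimes> r \<in> J"
  shows "socle R Q \<noteq> {\<zero>\<^bsub>Q\<^esub>}"
proof -
  have sat: "saturated L" if L: "left_ideal L R" "J \<subseteq> L" for L
    unfolding saturated_def
  proof (intro conjI L ballI impI)
    interpret L: additive_subgroup L R by (rule left_idealD(1)[OF L(1)])
    fix c r assume c: "c \<in> C" and r: "r \<in> carrier R" and cr: "c \<otimes> r \<in> L"
    have cc: "c \<in> carrier R" by (rule C_carrier[OF c])
    obtain d where d: "d \<in> carrier R" "\<one> \<ominus> c \<otimes> d \<in> J" using inv c by blast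
    \<comment> \<open>With d inverse to c modulo \<open>J\<close>, split r as (1 - cd)r + d(cr),
      using that c is central. The first summand is in \<open>J\<close>, the second in
      \<open>L\<close>.\<close>
    have "(\<one> \<ominus> c \<otimes> d) \<otimes> r \<in> L" using J.I_r_closed[OF d(2) r] L(2) by blast
    moreover have "d \<otimes> (c \<otimes> r) \<in> L" by (rule left_idealD(2)[OF L(1) d(1) cr])
    ultimately have "(\<one> \<ominus> c \<otimes> d) \<otimes> r \<oplus> d \<otimes> (c \<otimes> r) \<in> L" by (rule L.a_closed)
    moreover have "d \<otimes> (c \<otimes> r) = (c \<otimes> d) \<otimes> r"
      using centre_comm[of c d] c d cc r by (simp flip: m_assoc)
    ultimately have "(\<one> \<ominus> c \<otimes> d) \<otimes> r \<oplus> (c \<otimes> d) \<otimes> r \<in> L" by simp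
    moreover have "(\<one> \<ominus> c \<otimes> d) \<otimes> r \<oplus> (c \<otimes> d) \<otimes> r = r"
      using cc d r by (simp add: a_minus_def l_distr l_minus a_assoc l_neg)
    ultimately show "r \<in> L" by simp
  qed
  \<comment> \<open>So R itself is a left ideal strictly above \<open>J\<close>, and the family to
    be minimized is nonempty.\<close>
  have "\<one> \<notin> J" using one_in_C extended_inter_centre by blast
  then have "J \<subset> carrier R" using J.a_subset one_closed by blast
  moreover have "left_ideal (carrier R) R" by (rule left_idealI) simp_all
  ultimately have ne: "{L. left_ideal L R \<and> J \<subset> L} \<noteq> {}" by blast
  have "saturated L" if "L \<in> {L. left_ideal L R \<and> J \<subset> L}" for L
    using sat that by blast
  from saturated_minimal[OF ne this] obtain L where "L \<in> {L. left_ideal L R \<and> J \<subset> L}"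
    and min0: "\<forall>L'\<in>{L. left_ideal L R \<and> J \<subset> L}. L' \<subseteq> L \<longrightarrow> L' = L" ..
  then have L: "left_ideal L R" "J \<subset> L" by blast+
  have min: "L' = L" if "left_ideal L' R" "J \<subset> L'" "L' \<subseteq> L" for L'
    using min0 that by blast
  note S = minimal_left_ideal_simple[OF L min]
  have "g ` L \<subseteq> socle R Q"
    unfolding socle_def using S(1,2) by (blast intro: generate.incl)
  then show ?thesis
    using S(3) subgroup.one_closed[OF submodule.axioms(1)[OF S(1)]] by auto
qed

end

section \<open>The equivalence, as a cycle from (1) through (3) and (2) back to (1)\<close>

theorem theorem3p7:
  fixes R :: "('a, 'b) ring_scheme"
  assumes "ring R"
    and "\<And>\<pp>. \<pp> \<in> ZL R - Max_centre R \<Longrightarrow> inj_on (phi R \<pp>) (carrier (fibre_ring R \<pp>))"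
    and "\<And>\<pp>. \<pp> \<in> ZL R - Max_centre R \<Longrightarrow>
           simple_ring (fibre_tensor R \<pp>) \<and> artinian_ring (fibre_tensor R \<pp>)"
  shows "(PLM_ring R \<longleftrightarrow>
            (\<forall>\<pp> \<in> ZL R - Max_centre R.
               phi R \<pp> ` carrier (fibre_ring R \<pp>) \<noteq> carrier (fibre_localization R \<pp>))) \<and>
         ((\<forall>\<pp> \<in> ZL R - Max_centre R.
               phi R \<pp> ` carrier (fibre_ring R \<pp>) \<noteq> carrier (fibre_localization R \<pp>)) \<longleftrightarrow>
            (\<forall>\<pp> \<in> ZL R - Max_centre R.
               socle R (quotient_module R (extended_ideal R \<pp>)) =
                 {\<zero>\<^bsub>quotient_module R (extended_ideal R \<pp>)\<^esub>}))"
    (is "(?PLM \<longleftrightarrow> ?not_surj) \<and> (?not_surj \<longleftrightarrow> ?socle)")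
proof -
  have fibre: "simple_artinian_fibre R \<pp>" if "\<pp> \<in> ZL R - Max_centre R" for \<pp>
    using assms that
    by (simp add: simple_artinian_fibre_def simple_artinian_fibre_axioms_def
        torsion_free_fibre_def torsion_free_fibre_axioms_def central_prime_def central_prime_axioms_def)
  have "?socle" if ?PLM
    using torsion_free_fibre.PLM_socle_zero[OF simple_artinian_fibre.axioms(1)[OF fibre] that] by blast
  \<comment> \<open>By contraposition at each prime: surjectivity of phi makes \<open>C\<close>
    invertible modulo \<open>J\<close>, and then the socle is nonzero.\<close>
  moreover have "?not_surj" if soc: ?socle
  proof
    fix \<pp> assume p: "\<pp> \<in> ZL R - Max_centre R"
    interpret simple_artinian_fibre R \<pp> by (rule fibre[OF p])
    show "phi R \<pp> ` carrier (fibre_ring R \<pp>) \<noteq> carrier (fibre_localization R \<pp>)"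
      using bspec[OF soc p] denoms_invertible_socle unfolding phi_surj_iff by blast
  qed
  moreover have "?PLM" if ns: ?not_surj
    unfolding PLM_ring_def
  proof (intro conjI allI impI assms(1))
    fix M :: "('a, 'a set) module" assume M: "simple_left_module R M"
    interpret M: simple_module R M by (rule simple_moduleI[OF M])
    show "annihilator R M \<inter> centre R \<in> Max_centre R"
    proof (rule ccontr)
      assume nmax: "annihilator R M \<inter> centre R \<notin> Max_centre R"
      \<comment> \<open>The annihilator of a simple module is prime, so if its trace on the centre
        is not maximal, the hypotheses on the fibre apply to that trace. Every element of
        \<open>C\<close> is then invertible modulo \<open>J\<close>, that is, phi is surjective,
        contrary to (2).\<close>
      have "annihilator R M \<inter> centre R \<in> ZL R"
        unfolding ZL_def using M.prime_annihilator by blast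
      with nmax have p: "annihilator R M \<inter> centre R \<in> ZL R - Max_centre R" by blast
      interpret simple_artinian_fibre R "annihilator R M \<inter> centre R" by (rule fibre[OF p])
      show False
        using ns p phi_surj_iff simple_module_denoms_invertible[OF M refl] by blast
    qed
  qed
  ultimately show ?thesis by blast
qed

end
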